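(* Let $T>0$, let $X$ be an $\mathbb{N}$-valued random variable with density $f$ with respect to $\pi_T$, and let $a\in[0,1]$. Assume that $f$ is bounded away from zero and infinity. Let $(\lambda_t)_{0\le t\le T}$ be the Poisson–Föllmer intensity associated with $f$ on $[0,T]$. Then $(\lambda_t)_{0\le t\le aT}$ is the minimizing process for $T_a(X)$ with respect to the Poisson measure $\pi_{aT}$; that is, $X^\lambda_{aT}$ has the law of $T_a(X)$ and $(\lambda_t)_{0\le t\le aT}$ attains the infimum in $$H(T_a(X)|\pi_{aT})=\inf_{\nu}\ \mathbb{E}\int_0^{aT}\phi(\nu_t)\,dt,$$ where the infimum runs over all nonnegative, bounded, predictable processes $(\nu_t)_{0\le t\le aT}$ such that $X^{\nu}_{aT}$ has the law of $T_a(X)$. Therefore $$H(T_a(X)|\pi_{aT})=\mathbb{E}\int_0^{aT}\phi(\lambda_t)\,dt .$$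
   Context: $\mathbb{N}=\{0,1,2,\dots\}$; $\pi_t(k)=e^{-t}t^k/k!$ for $t>0$, and $\pi_0$ is the point mass at $0$. "$X$ has density $f$ with respect to $\pi_T$" means $\mathbb{P}(X=k)=f(k)\pi_T(k)$ for all $k$. "Bounded away from zero and infinity" means $0<c\le f\le C<\infty$ for some constants. $\phi(x)=x\log x-x+1$ on $[0,\infty)$ ($0\log 0=0$). The $a$-thinning is $T_a(X)=\sum_{i=1}^XB_i$ with $(B_i)$ i.i.d. Bernoulli($a$) independent of $X$. If $Y$ has density $g$ with respect to $\pi_t$, $H(Y|\pi_t)=\sum_k g(k)\log g(k)\,\pi_t(k)$. Poisson semigroup: $P_tg(k)=\sum_{n\in\mathbb{N}}g(k+n)\pi_t(n)$, $P_0g=g$. Poisson–Föllmer process: let $N$ be a Poisson point process on $[0,T]\times[0,\infty)$ with Lebesgue intensity, and let $\mathcal{F}_t=\sigma(N(F):F\subset[0,t]\times[0,\infty)\text{ Borel})$. A process $(\nu_t)$ is predictable if $(t,\omega)\mapsto\nu_t(\omega)$ is measurable with respect to the sigma-algebra generated by the sets $(s,t]\times B$ with $s\le t\le T$, $B\in\mathcal{F}_s$. For a bounded nonnegative predictable $\nu$, define the counting process $X^\nu_t=N(\{(s,x):s<t,\ x\le\nu_s\})$. The Poisson–Föllmer intensity associated with $f$ on $[0,T]$ is the bounded, nonnegative, predictable process $\lambda$ (known to exist and be unique for $f$ bounded away from zero and infinity) satisfying, with probability one and for all $t\in[0,T]$, $$\lambda_t=\frac{P_{T-t}f(X^\lambda_t+1)}{P_{T-t}f(X^\lambda_t)}.$$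 *)

theory Defs
  imports "HOL-Probability.Probability"
begin

section \<open>Poisson laws, densities, relative entropy, Poisson semigroup\<close>

text \<open>\<^const>\<open>poisson_pmf\<close> is only specified for a positive rate; at time 0 the law is
  the point mass at 0.\<close>

definition poisson_law :: "real \<Rightarrow> nat pmf" where
  "poisson_law t = (if t = 0 then return_pmf 0 else poisson_pmf t)"

definition has_poisson_density :: "'a measure \<Rightarrow> ('a \<Rightarrow> nat) \<Rightarrow> real \<Rightarrow> (nat \<Rightarrow> real) \<Rightarrow> bool" where
  "has_poisson_density M Y t g \<longleftrightarrow>
     (\<forall>k. measure M {\<omega> \<in> space M. Y \<omega> = k} = g k * pmf (poisson_law t) k)"

text \<open>The density of the law of \<open>Y\<close> is the quotient of point probabilities. It is determined
  wherever the Poisson weight is positive; elsewhere (only for \<open>t = 0\<close>, \<open>k > 0\<close>) its value is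
  irrelevant for the entropy, since the summand carries the factor 0.\<close>

definition poisson_density :: "'a measure \<Rightarrow> ('a \<Rightarrow> nat) \<Rightarrow> real \<Rightarrow> nat \<Rightarrow> real" where
  "poisson_density M Y t k = measure M {\<omega> \<in> space M. Y \<omega> = k} / pmf (poisson_law t) k"

text \<open>Meaningful if the law of \<open>Y\<close> is absolutely continuous with respect to the Poisson law and
  the series converges, e.g. if the density is bounded. The convention \<open>0 log 0 = 0\<close> holds
  because \<open>ln 0 = 0\<close>.\<close>

definition poisson_entropy :: "'a measure \<Rightarrow> ('a \<Rightarrow> nat) \<Rightarrow> real \<Rightarrow> real" where
  "poisson_entropy M Y t =
     (\<Sum>k. poisson_density M Y t k * ln (poisson_density M Y t k) * pmf (poisson_law t) k)"

definition poisson_semigroup :: "real \<Rightarrow> (nat \<Rightarrow> real) \<Rightarrow> nat \<Rightarrow> real" where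
  "poisson_semigroup t g k = (\<Sum>n. g (k + n) * pmf (poisson_law t) n)"

definition phi :: "real \<Rightarrow> real" where
  "phi x = x * ln x - x + 1"


section \<open>Thinning\<close>

text \<open>An i.i.d. Bernoulli sequence independent of \<open>X\<close>: the family \<open>X, B 0, B 1, \<dots>\<close> is mutually
  independent.\<close>

definition thinning_sequence ::
  "'b measure \<Rightarrow> ('b \<Rightarrow> nat) \<Rightarrow> real \<Rightarrow> (nat \<Rightarrow> 'b \<Rightarrow> nat) \<Rightarrow> bool" where
  "thinning_sequence M X a B \<longleftrightarrow>
     prob_space.indep_vars M (\<lambda>_. count_space UNIV) (case_nat X B) UNIV \<and>
     (\<forall>i. distr M (count_space UNIV) (B i) = measure_pmf (map_pmf of_bool (bernoulli_pmf a)))"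

definition thinning :: "('b \<Rightarrow> nat) \<Rightarrow> (nat \<Rightarrow> 'b \<Rightarrow> nat) \<Rightarrow> 'b \<Rightarrow> nat" where
  "thinning X B \<omega> = (\<Sum>i<X \<omega>. B i \<omega>)"


section \<open>Poisson point process on a strip and its filtration\<close>

definition strip :: "real \<Rightarrow> (real \<times> real) set" where
  "strip t = {0..t} \<times> {0..}"

text \<open>A point process is a random locally finite integer-valued Borel measure on the strip.\<close>

definition poisson_point_process ::
  "'w measure \<Rightarrow> real \<Rightarrow> ('w \<Rightarrow> (real \<times> real) measure) \<Rightarrow> bool" where
  "poisson_point_process M T N \<longleftrightarrow>
     (\<forall>\<omega>\<in>space M. sets (N \<omega>) = sets (restrict_space borel (strip T)) \<and>
        (\<forall>F\<in>sets (N \<omega>). bounded F \<longrightarrow> emeasure (N \<omega>) F \<in> \<nat>)) \<and>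
     (\<forall>F\<in>sets borel. F \<subseteq> strip T \<longrightarrow>
        (\<lambda>\<omega>. emeasure (N \<omega>) F) \<in> borel_measurable M \<and>
        (emeasure lborel F < \<infinity> \<longrightarrow>
           (\<forall>k. measure M {\<omega> \<in> space M. emeasure (N \<omega>) F = of_nat k} =
                pmf (poisson_law (measure lborel F)) k)) \<and>
        (emeasure lborel F = \<infinity> \<longrightarrow> (AE \<omega> in M. emeasure (N \<omega>) F = \<infinity>))) \<and>
     (\<forall>F :: nat \<Rightarrow> (real \<times> real) set.
        (\<forall>i. F i \<in> sets borel \<and> F i \<subseteq> strip T) \<and> disjoint_family F \<longrightarrow>
        prob_space.indep_vars M (\<lambda>_. borel) (\<lambda>i \<omega>. emeasure (N \<omega>) (F i)) UNIV)"

definition pp_filtration ::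
  "'w measure \<Rightarrow> ('w \<Rightarrow> (real \<times> real) measure) \<Rightarrow> real \<Rightarrow> 'w set set" where
  "pp_filtration M N t = sigma_sets (space M)
     {(\<lambda>\<omega>. emeasure (N \<omega>) F) -` A \<inter> space M | F A.
        F \<in> sets borel \<and> F \<subseteq> strip t \<and> A \<in> sets borel}"

definition predictable_algebra ::
  "'w measure \<Rightarrow> ('w \<Rightarrow> (real \<times> real) measure) \<Rightarrow> real \<Rightarrow> (real \<times> 'w) measure" where
  "predictable_algebra M N S = sigma ({0..S} \<times> space M)
     {{s<..t} \<times> A | s t A. 0 \<le> s \<and> s \<le> t \<and> t \<le> S \<and> A \<in> pp_filtration M N s}"

text \<open>Bounded nonnegative predictable processes on \<open>[0,S]\<close>; values outside \<open>[0,S]\<close> are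
  irrelevant.\<close>

definition intensity_process ::
  "'w measure \<Rightarrow> ('w \<Rightarrow> (real \<times> real) measure) \<Rightarrow> real \<Rightarrow> (real \<Rightarrow> 'w \<Rightarrow> real) \<Rightarrow> bool" where
  "intensity_process M N S \<nu> \<longleftrightarrow>
     (\<lambda>(t, \<omega>). \<nu> t \<omega>) \<in> borel_measurable (predictable_algebra M N S) \<and>
     (\<forall>t\<in>{0..S}. \<forall>\<omega>\<in>space M. 0 \<le> \<nu> t \<omega>) \<and>
     (\<exists>C. \<forall>t\<in>{0..S}. \<forall>\<omega>\<in>space M. \<nu> t \<omega> \<le> C)"

text \<open>For a bounded intensity the set below is bounded, so the measured value is a natural
  number and \<open>nat \<lfloor>_\<rfloor>\<close> only changes its type.\<close>

definition counting_process ::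
  "('w \<Rightarrow> (real \<times> real) measure) \<Rightarrow> (real \<Rightarrow> 'w \<Rightarrow> real) \<Rightarrow> real \<Rightarrow> 'w \<Rightarrow> nat" where
  "counting_process N \<nu> t \<omega> = nat \<lfloor>measure (N \<omega>) {(s, x) \<in> strip t. s < t \<and> x \<le> \<nu> s \<omega>}\<rfloor>"


section \<open>Poisson--Foellmer intensity and the variational problem\<close>

definition poisson_foellmer_intensity ::
  "'w measure \<Rightarrow> ('w \<Rightarrow> (real \<times> real) measure) \<Rightarrow> real \<Rightarrow> (nat \<Rightarrow> real) \<Rightarrow>
   (real \<Rightarrow> 'w \<Rightarrow> real) \<Rightarrow> bool" where
  "poisson_foellmer_intensity M N T f \<nu> \<longleftrightarrow>
     intensity_process M N T \<nu> \<and>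
     (AE \<omega> in M. \<forall>t\<in>{0..T}.
        \<nu> t \<omega> = poisson_semigroup (T - t) f (counting_process N \<nu> t \<omega> + 1) /
                poisson_semigroup (T - t) f (counting_process N \<nu> t \<omega>))"

definition intensity_cost :: "'w measure \<Rightarrow> real \<Rightarrow> (real \<Rightarrow> 'w \<Rightarrow> real) \<Rightarrow> real" where
  "intensity_cost M S \<nu> = (LINT \<omega>|M. (LINT t:{0..S}|lborel. phi (\<nu> t \<omega>)))"

text \<open>\<open>L\<close> is the prescribed law, on \<^typ>\<open>nat\<close> with the discrete sigma-algebra, of the counting
  process at time \<open>S\<close>.\<close>

definition admissible_intensities ::
  "'w measure \<Rightarrow> ('w \<Rightarrow> (real \<times> real) measure) \<Rightarrow> real \<Rightarrow> nat measure \<Rightarrow>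
   (real \<Rightarrow> 'w \<Rightarrow> real) set" where
  "admissible_intensities M N S L =
     {\<nu>. intensity_process M N S \<nu> \<and>
         distr M (count_space UNIV) (counting_process N \<nu> S) = L}"

end

theory Submission
  imports Defs
begin

text \<open>Put \<open>G(t,k) = P\<^bsub>T-t\<^esub>f(k)\<close>, which solves \<open>(d/dt) G(t,k) = G(t,k) - G(t,k+1)\<close>. Ito's formula
  for \<open>ln G(t, X\<^sup>\<nu>\<^sub>t)\<close> gives, with \<open>r = G(t,X\<^sup>\<nu>\<^sub>t+1)/G(t,X\<^sup>\<nu>\<^sub>t)\<close>,
  \<open>E ln G(S, X\<^sup>\<nu>\<^sub>S) = E \<integral> (\<nu> ln r - r + 1) dt \<le> E \<integral> \<phi>(\<nu>) dt\<close>, with equality if \<open>\<nu> = r\<close>.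
  If \<open>X\<^sup>\<nu>\<^sub>S\<close> has the law with density \<open>G(S,\<cdot>)\<close>, the left-hand side is the relative entropy.
  For \<open>S = aT\<close> this is the law of the thinning, by a direct computation, and also the law of
  \<open>X\<^sup>\<lambda>\<^sub>S\<close>, by Ito's formula for the quotients \<open>P\<^bsub>S-t\<^esub>(h G(S,\<cdot>)) / G(t,\<cdot>)\<close>.

  Ito's formula is obtained by discretising time: in a step of length \<open>\<delta>\<close> the process jumps
  at most once up to an error of order \<open>\<delta>\<^sup>2\<close>, and the expected increment is the compensator by
  the compensation formula for predictable sets, so that no path properties are needed.\<close>

section \<open>The Poisson semigroup\<close>

text \<open>One function \<open>G\<close> with horizon \<open>T\<close> serves the shorter interval
  as well. The density of the thinning with respect to the Poisson law at time S = aT is P_{T-S} f,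
  which is G(S,.), and on [0,S] the Foellmer intensity is a quotient of values of the same
  \<open>G\<close>. So the thinned target keeps the old drift, and only the terminal time in Ito's
  formula changes. As G(0,0) is the total mass of the law of X, the initial term ln G(0,0) vanishes.

  The obstacle is that a competitor \<nu> is merely bounded and predictable, with no continuity in
  time. Ito's formula is therefore first proved as a one-sided inequality, with the state frozen at
  the left end of each step and a right-hand side that depends on \<nu> through p(\<nu>) and a jump
  count. Competitors need only this inequality; for the Foellmer process, equality comes from
  applying it to F and to -F. The bounds on f keep \<open>G\<close> between positive constants, so
  that ln G and the quotients by \<open>G\<close> are bounded uniformly in time and state, and so
  are the constants in the error of a step.\<close>

lemma pmf_poisson_law: "0 \<le> t \<Longrightarrow> pmf (poisson_law t) n = exp (- t) * t ^ n / fact n"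
  by (auto simp: poisson_law_def pmf_poisson indicator_def power_0_left)

lemma summable_bounded_exp_series:
  fixes g :: "nat \<Rightarrow> real"
  assumes "\<And>k. \<bar>g k\<bar> \<le> K"
  shows "summable (\<lambda>n. g (k + n) / fact n * t ^ n)"
proof (rule summable_comparison_test')
  show "summable (\<lambda>n. K * (inverse (fact n) * \<bar>t\<bar> ^ n))"
    by (intro summable_mult summable_exp)
  show "norm (g (k + n) / fact n * t ^ n) \<le> K * (inverse (fact n) * \<bar>t\<bar> ^ n)" if "n \<ge> 0" for n
    using mult_right_mono[OF assms[of "k + n"], of "inverse (fact n) * \<bar>t\<bar> ^ n"]
    by (simp add: abs_mult power_abs divide_inverse mult_ac)
qed

text \<open>The second form is exp(-t) times an everywhere convergent power series in t, so termwise
  differentiation is available at every time, including t = 0.\<close>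

lemma poisson_semigroup_sums:
  fixes g :: "nat \<Rightarrow> real"
  assumes "\<And>k. \<bar>g k\<bar> \<le> K" "0 \<le> t"
  shows "(\<lambda>n. g (k + n) * pmf (poisson_law t) n) sums poisson_semigroup t g k"
    and "poisson_semigroup t g k = exp (- t) * (\<Sum>n. g (k + n) / fact n * t ^ n)"
proof -
  have *: "(\<lambda>n. g (k + n) * pmf (poisson_law t) n) = (\<lambda>n. exp (- t) * (g (k + n) / fact n * t ^ n))"
    using assms by (simp add: pmf_poisson_law fun_eq_iff)
  have s: "summable (\<lambda>n. g (k + n) / fact n * t ^ n)"
    by (rule summable_bounded_exp_series[OF assms(1)])
  show "(\<lambda>n. g (k + n) * pmf (poisson_law t) n) sums poisson_semigroup t g k"
    unfolding poisson_semigroup_def by (rule summable_sums) (simp only: * summable_mult[OF s])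
  show "poisson_semigroup t g k = exp (- t) * (\<Sum>n. g (k + n) / fact n * t ^ n)"
    unfolding poisson_semigroup_def * by (rule suminf_mult[OF s])
qed

lemma poisson_semigroup_const:
  assumes "0 \<le> t"
  shows "poisson_semigroup t (\<lambda>_. 1) k = 1"
proof -
  have "(\<Sum>n. 1 / fact n * t ^ n) = exp t"
    by (simp add: exp_def divide_inverse)
  then show ?thesis
    by (subst poisson_semigroup_sums(2)[of _ 1]) (simp_all add: assms exp_minus)
qed

lemma poisson_semigroup_ge:
  assumes "\<And>k. \<bar>g k\<bar> \<le> K" "0 \<le> t" "\<And>k. c \<le> g k"
  shows "c \<le> poisson_semigroup t g k"
proof -
  have "(\<lambda>n. c * (1 * pmf (poisson_law t) n)) sums (c * 1)"
    using sums_mult[OF poisson_semigroup_sums(1)[of "\<lambda>_. 1" 1 t k], of c] assms(2)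
      poisson_semigroup_const by simp
  from sums_le[OF _ this poisson_semigroup_sums(1)[OF assms(1,2)]] show ?thesis
    using assms(3) by (simp add: mult_right_mono)
qed

lemma poisson_semigroup_le:
  assumes "\<And>k. \<bar>g k\<bar> \<le> K" "0 \<le> t" "\<And>k. g k \<le> c"
  shows "poisson_semigroup t g k \<le> c"
proof -
  have "(\<lambda>n. c * (1 * pmf (poisson_law t) n)) sums (c * 1)"
    using sums_mult[OF poisson_semigroup_sums(1)[of "\<lambda>_. 1" 1 t k], of c] assms(2)
      poisson_semigroup_const by simp
  from sums_le[OF _ poisson_semigroup_sums(1)[OF assms(1,2)] this] show ?thesis
    using assms(3) by (simp add: mult_right_mono)
qed

lemma poisson_semigroup_0:
  assumes "\<And>k. \<bar>g k\<bar> \<le> K"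
  shows "poisson_semigroup 0 g k = g k"
  using powser_zero[of "\<lambda>n. g (k + n) / fact n"]
  by (simp add: poisson_semigroup_sums(2)[OF assms])

text \<open>Termwise differentiation shifts the coefficients g(k+n)/n! to g(k+1+n)/n!, which
  produces the value at k + 1; the factor exp(-t) contributes the minus term. The derivative is
  taken within \<open>{0..}\<close> because the series describes the semigroup for nonnegative times
  only.\<close>

lemma has_derivative_poisson_semigroup:
  assumes "\<And>k. \<bar>g k\<bar> \<le> K" "0 \<le> t"
  shows "((\<lambda>t. poisson_semigroup t g k) has_real_derivative
    poisson_semigroup t g (Suc k) - poisson_semigroup t g k) (at t within {0..})"
proof -
  define c where "c = (\<lambda>n. g (k + n) / fact n)"
  have dc: "diffs c = (\<lambda>n. g (Suc k + n) / fact n)"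
    by (auto simp: diffs_def c_def fun_eq_iff field_simps simp del: of_nat_Suc)
  have "summable (\<lambda>n. c n * y ^ n)" for y
    unfolding c_def by (rule summable_bounded_exp_series[OF assms(1)])
  then have "((\<lambda>t. \<Sum>n. c n * t ^ n) has_real_derivative (\<Sum>n. diffs c n * t ^ n)) (at t within {0..})"
    by (intro has_field_derivative_at_within[OF termdiffs_strong_converges_everywhere])
  then have "((\<lambda>t. exp (- t) * (\<Sum>n. c n * t ^ n)) has_real_derivative
      exp (- t) * (\<Sum>n. diffs c n * t ^ n) - exp (- t) * (\<Sum>n. c n * t ^ n)) (at t within {0..})"
    by (auto intro!: derivative_eq_intros)
  note deriv = this[unfolded dc, unfolded c_def]
  show ?thesis
    unfolding poisson_semigroup_sums(2)[OF assms]
    by (rule has_field_derivative_transform_within[OF deriv zero_less_one])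
       (use assms(2) in \<open>auto simp: poisson_semigroup_sums(2)[OF assms(1)]\<close>)
qed

lemma has_derivative_poisson_semigroup_backward:
  assumes "\<And>k. \<bar>g k\<bar> \<le> K" "u \<in> {0..S}" "S \<le> T"
  shows "((\<lambda>u. poisson_semigroup (T - u) g k) has_real_derivative
    poisson_semigroup (T - u) g k - poisson_semigroup (T - u) g (Suc k)) (at u within {0..S})"
proof -
  have "((\<lambda>t. poisson_semigroup t g k) has_real_derivative
      poisson_semigroup (T - u) g (Suc k) - poisson_semigroup (T - u) g k)
      (at (T - u) within (\<lambda>u. T - u) ` {0..S})"
    by (rule DERIV_subset[OF has_derivative_poisson_semigroup[OF assms(1)]]) (use assms in auto)
  moreover have "((\<lambda>u. T - u) has_real_derivative - 1) (at u within {0..S})"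
    by (auto intro!: derivative_eq_intros)
  ultimately show ?thesis
    using DERIV_image_chain by (fastforce simp: o_def)
qed

lemma continuous_on_poisson_semigroup_backward:
  assumes "\<And>k. \<bar>g k\<bar> \<le> K" "S \<le> T"
  shows "continuous_on {0..S} (\<lambda>u. poisson_semigroup (T - u) g k)"
  by (rule DERIV_continuous_on[OF has_derivative_poisson_semigroup_backward[OF assms(1) _ assms(2)]])

section \<open>The law of the thinning\<close>

text \<open>The number m of summands is kept apart from the value n of X. Then induction on m goes
  through with the event X = n fixed: each step adds one independent coin, and Pascal's rule closes
  it. The choice m = n is made in \<open>thinning_law\<close>.\<close>

lemma thinning_sequence_joint_law:
  fixes a :: real
  assumes "prob_space M" "X \<in> measurable M (count_space UNIV)"
    and "0 \<le> a" "a \<le> 1" and thin: "thinning_sequence M X a B"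
  shows "measure M {\<omega> \<in> space M. X \<omega> = n \<and> (\<Sum>i<m. B i \<omega>) = k} =
    measure M {\<omega> \<in> space M. X \<omega> = n} * ((m choose k) * a ^ k * (1 - a) ^ (m - k))"
proof (induction m arbitrary: k)
  case 0
  interpret prob_space M by fact
  show ?case
    by (cases k) auto
next
  case (Suc m)
  interpret prob_space M by fact
  have ind: "indep_vars (\<lambda>_. count_space UNIV) (case_nat X B) UNIV"
    and dB: "distr M (count_space UNIV) (B i) = measure_pmf (map_pmf of_bool (bernoulli_pmf a))" for i
    using thin by (auto simp: thinning_sequence_def)
  have B[measurable]: "B i \<in> measurable M (count_space UNIV)" for i
    using ind[unfolded indep_vars_def, THEN conjunct1, rule_format, of "Suc i"] by simp
  have X[measurable]: "X \<in> measurable M (count_space UNIV)"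
    by fact
  have B1: "prob {\<omega> \<in> space M. B m \<omega> = j} = pmf (map_pmf of_bool (bernoulli_pmf a)) j" for j
  proof -
    have "prob {\<omega> \<in> space M. B m \<omega> = j} = measure (distr M (count_space UNIV) (B m)) {j}"
      by (subst measure_distr) (auto intro!: arg_cong[where f=prob])
    then show ?thesis
      by (simp add: dB measure_pmf_single)
  qed
  have pmf0: "pmf (map_pmf of_bool (bernoulli_pmf a)) (0::nat) = 1 - a"
    and pmf1: "pmf (map_pmf of_bool (bernoulli_pmf a)) (1::nat) = a"
    using pmf_map_inj'[of "of_bool :: bool \<Rightarrow> nat" "bernoulli_pmf a" False]
      pmf_map_inj'[of "of_bool :: bool \<Rightarrow> nat" "bernoulli_pmf a" True] assms(3,4)
    by (auto simp: inj_def)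
  have AE_B: "AE \<omega> in M. B m \<omega> = 0 \<or> B m \<omega> = 1"
  proof -
    have "AE x in measure_pmf (map_pmf of_bool (bernoulli_pmf a)). x = 0 \<or> x = (1::nat)"
      by (auto simp: AE_measure_pmf_iff)
    then show ?thesis
      unfolding dB[of m, symmetric] by (subst (asm) AE_distr_iff) auto
  qed
  have S[measurable]: "(\<lambda>\<omega>. \<Sum>i<m. B i \<omega>) \<in> measurable M (count_space UNIV)"
    using borel_measurable_sum[of "{..<m}" B M] by (simp add: measurable_cong_sets[OF refl sets_borel_eq_count_space])
  \<comment> \<open>\<open>case_nat X B\<close> puts X at index 0 and \<open>B i\<close> at index
    \<open>Suc i\<close>. So the indices up to m carry X and the first m coins, and index
    \<open>Suc m\<close> carries the coin \<open>B m\<close>.\<close>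
  have prod: "prob {\<omega> \<in> space M. (X \<omega> = n \<and> (\<Sum>i<m. B i \<omega>) = l) \<and> B m \<omega> = j} =
      prob {\<omega> \<in> space M. X \<omega> = n \<and> (\<Sum>i<m. B i \<omega>) = l} * prob {\<omega> \<in> space M. B m \<omega> = j}" for l j
  proof -
    let ?C = "\<lambda>_. count_space UNIV :: nat measure"
    have "indep_var (PiM {..m} ?C) (\<lambda>\<omega>. restrict (\<lambda>i. case_nat X B i \<omega>) {..m})
        (PiM {Suc m} ?C) (\<lambda>\<omega>. restrict (\<lambda>i. case_nat X B i \<omega>) {Suc m})"
      by (rule indep_var_restrict[OF ind]) auto
    moreover have "(\<lambda>v. v 0 = n \<and> (\<Sum>i<m. v (Suc i)) = l) \<in> measurable (PiM {..m} ?C) (count_space UNIV)"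
    proof -
      have [measurable]: "(\<lambda>v. \<Sum>i<m. v (Suc i)) \<in> measurable (PiM {..m} ?C) (count_space UNIV)"
        using borel_measurable_sum[of "{..<m}" "\<lambda>i v. v (Suc i) :: nat" "PiM {..m} ?C"]
        by (auto simp: measurable_cong_sets[OF refl sets_borel_eq_count_space]
            intro!: measurable_component_singleton)
      have [measurable]: "(\<lambda>v. v 0) \<in> measurable (PiM {..m} ?C) (count_space UNIV)"
        by (rule measurable_component_singleton) auto
      show ?thesis
        by measurable
    qed
    moreover have "(\<lambda>v. v (Suc m) = j) \<in> measurable (PiM {Suc m} ?C) (count_space UNIV)"
    proof -
      have [measurable]: "(\<lambda>v. v (Suc m)) \<in> measurable (PiM {Suc m} ?C) (count_space UNIV)"
        by (rule measurable_component_singleton) auto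
      show ?thesis
        by measurable
    qed
    ultimately have "indep_var (count_space UNIV) ((\<lambda>v. v 0 = n \<and> (\<Sum>i<m. v (Suc i)) = l) \<circ>
         (\<lambda>\<omega>. restrict (\<lambda>i. case_nat X B i \<omega>) {..m}))
       (count_space UNIV) ((\<lambda>v. v (Suc m) = j) \<circ> (\<lambda>\<omega>. restrict (\<lambda>i. case_nat X B i \<omega>) {Suc m}))"
      by (rule indep_var_compose)
    from indep_varD[OF this, of "{True}" "{True}"] show ?thesis
      by (simp add: vimage_def Int_def conj_commute conj_left_commute cong: conj_cong)
  qed
  \<comment> \<open>Split by the value of the last coin. The guard k > 0 matters: k - 1 is truncated
    subtraction and would be 0 at k = 0.\<close>
  have "prob {\<omega> \<in> space M. X \<omega> = n \<and> (\<Sum>i<Suc m. B i \<omega>) = k} =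
      prob ({\<omega> \<in> space M. (X \<omega> = n \<and> (\<Sum>i<m. B i \<omega>) = k) \<and> B m \<omega> = 0} \<union>
        {\<omega> \<in> space M. (X \<omega> = n \<and> (\<Sum>i<m. B i \<omega>) = k - 1) \<and> B m \<omega> = 1 \<and> k > 0})"
    by (rule finite_measure_eq_AE) (use AE_B in auto)
  also have "\<dots> = prob {\<omega> \<in> space M. (X \<omega> = n \<and> (\<Sum>i<m. B i \<omega>) = k) \<and> B m \<omega> = 0} +
        prob {\<omega> \<in> space M. (X \<omega> = n \<and> (\<Sum>i<m. B i \<omega>) = k - 1) \<and> B m \<omega> = 1 \<and> k > 0}"
    by (rule finite_measure_Union) auto
  also have "prob {\<omega> \<in> space M. (X \<omega> = n \<and> (\<Sum>i<m. B i \<omega>) = k - 1) \<and> B m \<omega> = 1 \<and> k > 0} =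
      (if k = 0 then 0 else prob {\<omega> \<in> space M. (X \<omega> = n \<and> (\<Sum>i<m. B i \<omega>) = k - 1) \<and> B m \<omega> = 1})"
    by auto
  finally have step: "prob {\<omega> \<in> space M. X \<omega> = n \<and> (\<Sum>i<Suc m. B i \<omega>) = k} =
      prob {\<omega> \<in> space M. X \<omega> = n} * ((m choose k) * a ^ k * (1 - a) ^ (m - k)) * (1 - a) +
      (if k = 0 then 0
       else prob {\<omega> \<in> space M. X \<omega> = n} * ((m choose (k - 1)) * a ^ (k - 1) * (1 - a) ^ (m - (k - 1))) * a)"
    unfolding prod Suc.IH B1 pmf0 pmf1 .
  show ?case
  proof (cases k)
    case 0
    then show ?thesis
      unfolding step by simp
  next
    case (Suc j)
    \<comment> \<open>The three cases remove truncated subtraction from the exponents; for m < j all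
      binomial coefficients vanish.\<close>
    consider "m < j" | "m = j" | d where "m = Suc j + d"
      by (metis less_imp_Suc_add linorder_cases add_Suc)
    then show ?thesis
      unfolding step by cases (auto simp: Suc algebra_simps binomial_eq_0)
  qed
qed

text \<open>This is Poisson splitting: the weight of n + k at time T, times the binomial probability
  of k successes among n + k, factorises into the weight of k at time aT and the weight of n at time
  T - aT. Summing f(k+n) against the latter is the semigroup at time T - aT.\<close>

lemma thinning_law:
  assumes "prob_space M" and X[measurable]: "X \<in> measurable M (count_space UNIV)"
    and a: "0 \<le> a" "a \<le> 1" and thin: "thinning_sequence M X a B"
    and "0 \<le> T" "has_poisson_density M X T f" "\<And>k. \<bar>f k\<bar> \<le> C"
  shows "thinning X B \<in> measurable M (count_space UNIV)"
    and "measure M {\<omega> \<in> space M. thinning X B \<omega> = k} =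
      poisson_semigroup (T - a * T) f k * pmf (poisson_law (a * T)) k"
proof -
  interpret prob_space M by fact
  have ind: "indep_vars (\<lambda>_. count_space UNIV) (case_nat X B) UNIV"
    using thin by (auto simp: thinning_sequence_def)
  have [measurable]: "B i \<in> measurable M (count_space UNIV)" for i
    using ind[unfolded indep_vars_def, THEN conjunct1, rule_format, of "Suc i"] by simp
  have S[measurable]: "(\<lambda>\<omega>. \<Sum>i<m. B i \<omega>) \<in> measurable M (count_space UNIV)" for m
    using borel_measurable_sum[of "{..<m}" B M] by (simp add: measurable_cong_sets[OF refl sets_borel_eq_count_space])
  show [measurable]: "thinning X B \<in> measurable M (count_space UNIV)"
    unfolding thinning_def[abs_def] by (rule measurable_compose_countable[OF S X])
  have "(\<lambda>n. prob {\<omega> \<in> space M. X \<omega> = n \<and> (\<Sum>i<n. B i \<omega>) = k}) sums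
      prob (\<Union>n. {\<omega> \<in> space M. X \<omega> = n \<and> (\<Sum>i<n. B i \<omega>) = k})"
    by (rule finite_measure_UNION) (auto simp: disjoint_family_on_def)
  also have "(\<Union>n. {\<omega> \<in> space M. X \<omega> = n \<and> (\<Sum>i<n. B i \<omega>) = k}) = {\<omega> \<in> space M. thinning X B \<omega> = k}"
    by (auto simp: thinning_def)
  finally have *: "(\<lambda>n. f n * pmf (poisson_law T) n * ((n choose k) * a ^ k * (1 - a) ^ (n - k))) sums
      prob {\<omega> \<in> space M. thinning X B \<omega> = k}"
    using assms(7) thinning_sequence_joint_law[OF assms(1-5)]
    by (simp add: has_poisson_density_def)
  \<comment> \<open>The terms with n < k carry a vanishing binomial coefficient, so the series may
    start at k.\<close>
  have "(\<lambda>n. f (n + k) * pmf (poisson_law T) (n + k) * (((n + k) choose k) * a ^ k * (1 - a) ^ n)) sums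
      prob {\<omega> \<in> space M. thinning X B \<omega> = k}"
    using sums_zero_iff_shift[THEN iffD2, OF _ *, of k] by (simp add: binomial_eq_0)
  moreover have "f (n + k) * pmf (poisson_law T) (n + k) * (((n + k) choose k) * a ^ k * (1 - a) ^ n) =
      f (k + n) * pmf (poisson_law (T - a * T)) n * pmf (poisson_law (a * T)) k" for n
  proof -
    have aT: "0 \<le> a * T" "0 \<le> T - a * T"
      using a \<open>0 \<le> T\<close> mult_right_mono[of a 1 T] by auto
    have e: "exp (- (T - a * T)) * exp (- (a * T)) = exp (- T)"
      by (simp flip: exp_add)
    have p: "(T - a * T) ^ n = (1 - a) ^ n * T ^ n"
      by (simp flip: power_mult_distrib add: algebra_simps)
    have c: "real ((n + k) choose k) = fact (n + k) / (fact k * fact n)"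
      by (subst binomial_fact) (auto simp: mult.commute)
    show ?thesis
      unfolding pmf_poisson_law[OF \<open>0 \<le> T\<close>] pmf_poisson_law[OF aT(1)] pmf_poisson_law[OF aT(2)] e[symmetric] p c
      by (simp add: field_simps power_add)
  qed
  ultimately have 1: "(\<lambda>n. f (k + n) * pmf (poisson_law (T - a * T)) n * pmf (poisson_law (a * T)) k) sums
      prob {\<omega> \<in> space M. thinning X B \<omega> = k}"
    by simp
  have "0 \<le> T - a * T"
    using a \<open>0 \<le> T\<close> mult_right_mono[of a 1 T] by auto
  from sums_mult2[OF poisson_semigroup_sums(1)[of f, OF assms(8) this, of k], of "pmf (poisson_law (a * T)) k"]
  show "prob {\<omega> \<in> space M. thinning X B \<omega> = k} =
      poisson_semigroup (T - a * T) f k * pmf (poisson_law (a * T)) k"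
    using 1 sums_unique2 by blast
qed

section \<open>Poisson point processes on a strip\<close>

text \<open>An index shift turns k times the weight of k into \<mu> times the weight of k - 1. The
  second moment is taken in factorial form because k(k-1) vanishes for k < 2 and has mean \<mu>
  squared, which is what estimates the event of two or more jumps.\<close>

lemma sums_poisson_law:
  assumes "0 \<le> \<mu>"
  shows "pmf (poisson_law \<mu>) sums 1"
    and "(\<lambda>k. real k * pmf (poisson_law \<mu>) k) sums \<mu>"
    and "(\<lambda>k. real k * (real k - 1) * pmf (poisson_law \<mu>) k) sums \<mu>\<^sup>2"
proof -
  show 0: "pmf (poisson_law \<mu>) sums 1"
    using poisson_semigroup_sums(1)[of "\<lambda>_. 1" 1 \<mu> 0] assms by (simp add: poisson_semigroup_const)
  have "(\<lambda>k. real (Suc k) * pmf (poisson_law \<mu>) (Suc k)) = (\<lambda>k. \<mu> * pmf (poisson_law \<mu>) k)"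
    using assms by (auto simp: pmf_poisson_law fun_eq_iff divide_simps simp del: of_nat_Suc)
  then show 1: "(\<lambda>k. real k * pmf (poisson_law \<mu>) k) sums \<mu>"
    using sums_Suc[of "\<lambda>k. real k * pmf (poisson_law \<mu>) k" \<mu>] sums_mult[OF 0, of \<mu>]
    by simp
  have "(\<lambda>k. real (Suc k) * (real (Suc k) - 1) * pmf (poisson_law \<mu>) (Suc k)) =
      (\<lambda>k. \<mu> * (real k * pmf (poisson_law \<mu>) k))"
    using assms by (auto simp: pmf_poisson_law fun_eq_iff divide_simps simp del: of_nat_Suc)
  then show "(\<lambda>k. real k * (real k - 1) * pmf (poisson_law \<mu>) k) sums \<mu>\<^sup>2"
    using sums_Suc[of "\<lambda>k. real k * (real k - 1) * pmf (poisson_law \<mu>) k" "\<mu>\<^sup>2"] sums_mult[OF 1, of \<mu>]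
    by (simp add: power2_eq_square)
qed

lemma (in prob_space) nn_integral_nat_valued:
  assumes [measurable]: "Z \<in> measurable M (count_space UNIV)"
    and law: "\<And>k. prob {\<omega> \<in> space M. Z \<omega> = k} = pmf p k"
    and h: "\<And>k :: nat. 0 \<le> h k" "(\<lambda>k. h k * pmf p k) sums s"
  shows "(\<integral>\<^sup>+\<omega>. ennreal (h (Z \<omega>)) \<partial>M) = ennreal s"
proof -
  have distr: "distr M (count_space UNIV) Z = measure_pmf p"
  proof (rule measure_eqI_countable)
    fix k
    have "Z -` {k} \<inter> space M = {\<omega> \<in> space M. Z \<omega> = k}"
      by auto
    then show "emeasure (distr M (count_space UNIV) Z) {k} = emeasure (measure_pmf p) {k}"
      by (simp add: emeasure_distr emeasure_eq_measure law emeasure_pmf_single)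
  qed auto
  have "(\<integral>\<^sup>+\<omega>. ennreal (h (Z \<omega>)) \<partial>M) = (\<integral>\<^sup>+k. ennreal (h k) \<partial>distr M (count_space UNIV) Z)"
    by (simp add: nn_integral_distr)
  also have "\<dots> = (\<Sum>k. ennreal (pmf p k * h k))"
    by (simp add: distr nn_integral_measure_pmf nn_integral_count_space_nat ennreal_mult h)
  also have "\<dots> = ennreal s"
    using h by (intro suminf_ennreal_eq) (auto simp: mult.commute)
  finally show ?thesis .
qed

lemma strip_borel [measurable, simp]: "strip t \<in> sets borel"
  unfolding strip_def by (intro borel_closed closed_Times) auto

lemma strip_mono: "s \<le> t \<Longrightarrow> strip s \<subseteq> strip t"
  by (auto simp: strip_def)

section \<open>Point counts, their moments, and independence of past and future\<close>

locale strip_poisson_process = prob_space M for M :: "'w measure" +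
  fixes N :: "'w \<Rightarrow> (real \<times> real) measure" and T :: real
  assumes ppp: "poisson_point_process M T N"
begin

text \<open>The rounding is the one in \<open>counting_process\<close>, so that the counting process
  is literally \<open>points\<close> of a random region.\<close>

definition points :: "(real \<times> real) set \<Rightarrow> 'w \<Rightarrow> nat" where
  "points F \<omega> = nat \<lfloor>measure (N \<omega>) F\<rfloor>"

lemma sets_N: "\<omega> \<in> space M \<Longrightarrow> F \<in> sets (N \<omega>) \<longleftrightarrow> F \<in> sets borel \<and> F \<subseteq> strip T"
  using ppp unfolding poisson_point_process_def
  by (auto simp: sets_restrict_space_iff)

lemma measurable_emeasure_N:
  assumes "F \<in> sets borel" "F \<subseteq> strip T"
  shows "(\<lambda>\<omega>. emeasure (N \<omega>) F) \<in> borel_measurable M"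
  using assms ppp unfolding poisson_point_process_def by auto

lemma emeasure_N_eq_points:
  assumes "\<omega> \<in> space M" "F \<in> sets borel" "F \<subseteq> strip T" "bounded F"
  shows "emeasure (N \<omega>) F = of_nat (points F \<omega>)"
proof -
  have "\<forall>F\<in>sets (N \<omega>). bounded F \<longrightarrow> emeasure (N \<omega>) F \<in> \<nat>"
    using ppp assms(1) unfolding poisson_point_process_def by blast
  then have "emeasure (N \<omega>) F \<in> \<nat>"
    using assms sets_N by blast
  then obtain n where "emeasure (N \<omega>) F = of_nat n"
    by (auto simp: Nats_def)
  then show ?thesis
    by (simp add: points_def measure_def)
qed

lemma measurable_points:
  assumes "F \<in> sets borel" "F \<subseteq> strip T"
  shows "points F \<in> measurable M (count_space UNIV)"
proof -
  have [measurable]: "(\<lambda>\<omega>. emeasure (N \<omega>) F) \<in> borel_measurable M"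
    by (rule measurable_emeasure_N[OF assms])
  show ?thesis
    unfolding points_def[abs_def] measure_def by measurable
qed

lemma points_law:
  assumes F: "F \<in> sets borel" "F \<subseteq> strip T" "bounded F"
  shows "prob {\<omega> \<in> space M. points F \<omega> = k} = pmf (poisson_law (measure lborel F)) k"
proof -
  have "prob {\<omega> \<in> space M. emeasure (N \<omega>) F = of_nat k} = pmf (poisson_law (measure lborel F)) k"
    using F ppp emeasure_bounded_finite[OF F(3)] unfolding poisson_point_process_def by auto
  also have "{\<omega> \<in> space M. emeasure (N \<omega>) F = of_nat k} = {\<omega> \<in> space M. points F \<omega> = k}"
    by (rule Collect_cong, rule conj_cong[OF refl]) (simp only: emeasure_N_eq_points[OF _ F], simp)
  finally show ?thesis .
qed

lemma nn_integral_emeasure_N: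
  assumes F: "F \<in> sets borel" "F \<subseteq> strip T" "bounded F"
  shows "(\<integral>\<^sup>+\<omega>. emeasure (N \<omega>) F \<partial>M) = emeasure lborel F"
proof -
  have "(\<integral>\<^sup>+\<omega>. emeasure (N \<omega>) F \<partial>M) = (\<integral>\<^sup>+\<omega>. ennreal (real (points F \<omega>)) \<partial>M)"
    by (intro nn_integral_cong) (simp add: emeasure_N_eq_points[OF _ F] ennreal_of_nat_eq_real_of_nat)
  also have "\<dots> = ennreal (measure lborel F)"
    by (rule nn_integral_nat_valued[OF measurable_points[OF F(1,2)] points_law[OF F]])
       (auto intro: sums_poisson_law)
  also have "\<dots> = emeasure lborel F"
    using emeasure_bounded_finite[OF F(3)] by (simp add: emeasure_eq_ennreal_measure)
  finally show ?thesis .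
qed

lemma points_moments:
  assumes F: "F \<in> sets borel" "F \<subseteq> strip T" "bounded F"
  shows "integrable M (\<lambda>\<omega>. real (points F \<omega>))"
    and "expectation (\<lambda>\<omega>. real (points F \<omega>)) = measure lborel F"
    and "integrable M (\<lambda>\<omega>. real (points F \<omega>) * (real (points F \<omega>) - 1))"
    and "expectation (\<lambda>\<omega>. real (points F \<omega>) * (real (points F \<omega>) - 1)) = (measure lborel F)\<^sup>2"
proof -
  note [measurable] = measurable_points[OF F(1,2)]
  have nonneg: "0 \<le> real k * (real k - 1)" for k
    by (cases k) auto
  have 1: "(\<integral>\<^sup>+\<omega>. ennreal (real (points F \<omega>)) \<partial>M) = ennreal (measure lborel F)"
    by (rule nn_integral_nat_valued[OF _ points_law[OF F]])
       (auto intro: sums_poisson_law)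
  have 2: "(\<integral>\<^sup>+\<omega>. ennreal (real (points F \<omega>) * (real (points F \<omega>) - 1)) \<partial>M) = ennreal ((measure lborel F)\<^sup>2)"
    by (rule nn_integral_nat_valued[OF _ points_law[OF F], where h="\<lambda>k. real k * (real k - 1)"])
       (auto intro: sums_poisson_law nonneg)
  show "integrable M (\<lambda>\<omega>. real (points F \<omega>))"
    using 1 by (intro integrableI_nonneg) auto
  show "integrable M (\<lambda>\<omega>. real (points F \<omega>) * (real (points F \<omega>) - 1))"
    using 2 nonneg by (intro integrableI_nonneg) auto
  show "expectation (\<lambda>\<omega>. real (points F \<omega>)) = measure lborel F"
    using 1 by (subst integral_eq_nn_integral) auto
  show "expectation (\<lambda>\<omega>. real (points F \<omega>) * (real (points F \<omega>) - 1)) = (measure lborel F)\<^sup>2"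
    using 2 nonneg by (subst integral_eq_nn_integral) auto
qed

lemma pp_filtration_mono:
  assumes "s \<le> t"
  shows "pp_filtration M N s \<subseteq> pp_filtration M N t"
  unfolding pp_filtration_def by (intro sigma_sets_mono') (use strip_mono[OF assms] in blast)

lemma pp_filtration_subset_sets:
  assumes "t \<le> T"
  shows "pp_filtration M N t \<subseteq> sets M"
  unfolding pp_filtration_def
proof (rule sets.sigma_sets_subset, safe)
  fix F :: "(real \<times> real) set" and A :: "ennreal set"
  assume "F \<in> sets borel" "F \<subseteq> strip t" "A \<in> sets borel"
  then show "(\<lambda>\<omega>. emeasure (N \<omega>) F) -` A \<inter> space M \<in> sets M"
    using measurable_emeasure_N[of F] strip_mono[OF assms] by (auto intro: measurable_sets)
qed

text \<open>The past is generated by the events below, which are closed under intersection; each of them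
  is a function of the masses of finitely many disjoint cells, to which the independence of masses
  of disjoint sets applies.\<close>

lemma past_independent_of_future:
  assumes s: "s \<le> T" and A: "A \<in> pp_filtration M N s"
    and G: "G \<in> sets borel" "G \<subseteq> strip T" "bounded G" "G \<inter> strip s = {}"
  shows "(\<integral>\<^sup>+\<omega>. indicator A \<omega> * emeasure (N \<omega>) G \<partial>M) = emeasure M A * emeasure lborel G"
proof -
  define \<Gamma> where "\<Gamma> = {(F, B). F \<in> sets borel \<and> F \<subseteq> strip s \<and> B \<in> sets (borel :: ennreal measure)}"
  define ev where "ev I = {\<omega> \<in> space M. \<forall>(F, B)\<in>I. emeasure (N \<omega>) F \<in> B}"
    for I :: "((real \<times> real) set \<times> ennreal set) set"
  define \<G> where "\<G> = {ev I | I. finite I \<and> I \<subseteq> \<Gamma>}"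
  have \<Gamma>T: "F \<in> sets borel" "F \<subseteq> strip T" "B \<in> sets borel" if "(F, B) \<in> \<Gamma>" for F B
    using that strip_mono[OF s] by (auto simp: \<Gamma>_def)
  have ev_Int: "ev I \<inter> ev J = ev (I \<union> J)" for I J
    by (auto simp: ev_def)
  have "Int_stable \<G>"
  proof (rule Int_stableI)
    fix a b assume "a \<in> \<G>" "b \<in> \<G>"
    then obtain I J where "a = ev I" "b = ev J" "finite (I \<union> J)" "I \<union> J \<subseteq> \<Gamma>"
      unfolding \<G>_def by blast
    then show "a \<inter> b \<in> \<G>"
      unfolding \<G>_def using ev_Int by blast
  qed
  moreover have closed: "\<G> \<subseteq> Pow (space M)"
    by (auto simp: \<G>_def ev_def)
  have ev_sets: "ev I \<in> sets M" if "finite I" "I \<subseteq> \<Gamma>" for I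
  proof -
    have "{\<omega> \<in> space M. \<forall>p\<in>I. emeasure (N \<omega>) (fst p) \<in> snd p} \<in> sets M"
    proof (rule sets.sets_Collect_finite_All[OF _ \<open>finite I\<close>])
      fix p assume "p \<in> I"
      then have [measurable]: "snd p \<in> sets borel" "(\<lambda>\<omega>. emeasure (N \<omega>) (fst p)) \<in> borel_measurable M"
        using that \<Gamma>T[of "fst p" "snd p"] by (auto intro!: measurable_emeasure_N)
      show "{\<omega> \<in> space M. emeasure (N \<omega>) (fst p) \<in> snd p} \<in> sets M"
        by measurable
    qed
    then show ?thesis
      by (simp add: ev_def split_beta)
  qed
  have \<G>_sets: "sigma_sets (space M) \<G> \<subseteq> sets M"
    by (rule sets.sigma_sets_subset) (auto simp: \<G>_def ev_sets)
  have "A \<in> sigma_sets (space M) \<G>"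
  proof (rule subsetD[OF sigma_sets_mono' A[unfolded pp_filtration_def]], safe)
    fix F :: "(real \<times> real) set" and B :: "ennreal set"
    assume "F \<in> sets borel" "F \<subseteq> strip s" "B \<in> sets borel"
    then have "(\<lambda>\<omega>. emeasure (N \<omega>) F) -` B \<inter> space M = ev {(F, B)}" "{(F, B)} \<subseteq> \<Gamma>"
      by (auto simp: ev_def \<Gamma>_def)
    then show "(\<lambda>\<omega>. emeasure (N \<omega>) F) -` B \<inter> space M \<in> \<G>"
      unfolding \<G>_def by blast
  qed
  note [measurable] = measurable_emeasure_N[OF G(1,2)]
  have G_fin: "emeasure lborel G < \<infinity>"
    by (rule emeasure_bounded_finite[OF G(3)])
  show ?thesis
    using \<open>Int_stable \<G>\<close> closed \<open>A \<in> sigma_sets (space M) \<G>\<close>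
  proof (induction rule: sigma_sets_induct_disjoint)
    case (basic A)
    then obtain I where I: "finite I" "I \<subseteq> \<Gamma>" and A: "A = ev I"
      by (auto simp: \<G>_def)
    define \<F> where "\<F> = fst ` I"
    have \<F>: "finite \<F>" "\<And>F. F \<in> \<F> \<Longrightarrow> F \<in> sets borel \<and> F \<subseteq> strip s"
    proof -
      show "finite \<F>"
        by (simp add: \<F>_def I)
      fix F assume "F \<in> \<F>"
      then obtain p where "p \<in> \<Gamma>" "F = fst p"
        using I(2) by (auto simp: \<F>_def)
      then show "F \<in> sets borel \<and> F \<subseteq> strip s"
        unfolding \<Gamma>_def by (simp add: split_beta)
    qed
    have "finite (Pow \<F> - {{}})"
      using \<F>(1) by simp
    from ex_bij_betw_nat_finite[OF this]
    obtain e and m :: nat where e: "bij_betw e {0..<m} (Pow \<F> - {{}})"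
      by blast
    have e_sub: "e i \<subseteq> \<F>" "e i \<noteq> {}" "finite (e i)" if "i < m" for i
      using bij_betwE[OF e, rule_format, of i] that finite_subset[OF _ \<F>(1), of "e i"] by auto
    \<comment> \<open>The first m cells are the atoms cut out by the finite family:
      \<open>E i\<close> consists of the points that lie in the members of \<open>e i\<close> and in
      no other member. Index m carries \<open>G\<close>, and the sequence is padded with the empty
      set because independence is postulated for infinite sequences.\<close>
    define E where "E i = (if i < m then \<Inter>(e i) - \<Union>(\<F> - e i) else if i = m then G else {})" for i
    have E_cell: "E i \<in> sets borel" "E i \<subseteq> strip s" if "i < m" for i
    proof -
      show "E i \<in> sets borel"
        using sets.finite_INT[of "e i" "\<lambda>F. F" borel] sets.finite_Union[of "\<F> - e i" borel]
          e_sub[OF that] \<F> that by (auto simp: E_def)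
      show "E i \<subseteq> strip s"
        using e_sub[OF that] \<F> that by (fastforce simp: E_def)
    qed
    have E_T: "E i \<in> sets borel" "E i \<subseteq> strip T" for i
      using E_cell[of i] G strip_mono[OF s] by (cases "i < m"; auto simp: E_def)+
    have disj: "disjoint_family E"
      unfolding disjoint_family_on_def
    proof (intro ballI impI)
      have cells: "E i \<inter> E j = {}" if "i < m" "j < m" "i \<noteq> j" for i j
      proof -
        have "e i \<noteq> e j"
          using bij_betw_imp_inj_on[OF e] that by (auto dest: inj_onD)
        then show ?thesis
          using e_sub[OF that(1)] e_sub[OF that(2)] that by (auto simp: E_def)
      qed
      have "E i \<inter> G = {}" if "i < m" for i
        using E_cell(2)[OF that] G(4) by auto
      then show "E i \<inter> E j = {}" if "i \<noteq> j" for i j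
        using cells[of i j] that by (cases "i < m"; cases "j < m") (auto simp: E_def)
    qed
    have ind: "indep_vars (\<lambda>_. borel) (\<lambda>i \<omega>. emeasure (N \<omega>) (E i)) UNIV"
      using ppp E_T disj unfolding poisson_point_process_def by auto
    have decomp: "emeasure (N \<omega>) F = (\<Sum>i\<in>{i. i < m \<and> F \<in> e i}. emeasure (N \<omega>) (E i))"
      if "F \<in> \<F>" "\<omega> \<in> space M" for F \<omega>
    proof -
      have "F = (\<Union>i\<in>{i. i < m \<and> F \<in> e i}. E i)"
      proof safe
        fix a b assume "(a, b) \<in> F"
        then have "{F\<in>\<F>. (a, b) \<in> F} \<in> Pow \<F> - {{}}"
          using \<open>F \<in> \<F>\<close> by auto
        then obtain i where "i < m" "e i = {F\<in>\<F>. (a, b) \<in> F}"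
          using e unfolding bij_betw_def by (metis (no_types, lifting) imageE atLeastLessThan_iff)
        then show "(a, b) \<in> (\<Union>i\<in>{i. i < m \<and> F \<in> e i}. E i)"
          using \<open>F \<in> \<F>\<close> \<open>(a, b) \<in> F\<close> by (auto simp: E_def)
      qed (auto simp: E_def)
      moreover have "(\<Sum>i\<in>{i. i < m \<and> F \<in> e i}. emeasure (N \<omega>) (E i)) =
          emeasure (N \<omega>) (\<Union>i\<in>{i. i < m \<and> F \<in> e i}. E i)"
        by (rule sum_emeasure) (use E_T disj that in \<open>auto simp: sets_N disjoint_family_on_def\<close>)
      ultimately show ?thesis
        by simp
    qed
    \<comment> \<open>\<open>Q\<close> expresses the event \<open>ev I\<close> through the cell
      masses alone: by \<open>decomp\<close>, the mass of a member of the family is the sum over the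
      cells contained in it.\<close>
    define Q where "Q = (\<lambda>v :: nat \<Rightarrow> ennreal. \<forall>p\<in>I. (\<Sum>i\<in>{i. i < m \<and> fst p \<in> e i}. v i) \<in> snd p)"
    let ?B = "\<lambda>_::nat. borel :: ennreal measure"
    have "indep_var (PiM {..<m} ?B) (\<lambda>\<omega>. restrict (\<lambda>i. emeasure (N \<omega>) (E i)) {..<m})
        (PiM {m} ?B) (\<lambda>\<omega>. restrict (\<lambda>i. emeasure (N \<omega>) (E i)) {m})"
      by (rule indep_var_restrict[OF ind]) auto
    moreover have "(\<lambda>v. indicator {v. Q v} v :: ennreal) \<in> borel_measurable (PiM {..<m} ?B)"
    proof -
      have "{v \<in> space (PiM {..<m} ?B). Q v} \<in> sets (PiM {..<m} ?B)"
        unfolding Q_def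
      proof (rule sets.sets_Collect_finite_All[OF _ \<open>finite I\<close>])
        fix p assume "p \<in> I"
        have [measurable]: "snd p \<in> sets borel"
          using \<open>p \<in> I\<close> I \<Gamma>T[of "fst p" "snd p"] by auto
        have [measurable]: "(\<lambda>v. \<Sum>i\<in>{i. i < m \<and> fst p \<in> e i}. v i) \<in> borel_measurable (PiM {..<m} ?B)"
          by (intro borel_measurable_sum measurable_component_singleton) auto
        show "{v \<in> space (PiM {..<m} ?B). (\<Sum>i\<in>{i. i < m \<and> fst p \<in> e i}. v i) \<in> snd p} \<in> sets (PiM {..<m} ?B)"
          by measurable
      qed
      then show ?thesis
        by (subst measurable_cong[of _ _ "indicator {v \<in> space (PiM {..<m} ?B). Q v}"])
           (auto simp: indicator_def)
    qed
    moreover have "(\<lambda>v. v m) \<in> borel_measurable (PiM {m} ?B)"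
      by (rule measurable_component_singleton) auto
    ultimately have "indep_var borel ((\<lambda>v. indicator {v. Q v} v :: ennreal) \<circ> (\<lambda>\<omega>. restrict (\<lambda>i. emeasure (N \<omega>) (E i)) {..<m}))
        borel ((\<lambda>v. v m) \<circ> (\<lambda>\<omega>. restrict (\<lambda>i. emeasure (N \<omega>) (E i)) {m}))" (is "indep_var borel ?f borel ?g")
      by (rule indep_var_compose)
    then have "indep_vars (\<lambda>_. borel) (case_bool ?f ?g) UNIV"
      unfolding indep_var_def by (rule indep_vars_cong[THEN iffD1, rotated -1]) (auto split: bool.split)
    from indep_vars_nn_integral[OF _ this]
    have "(\<integral>\<^sup>+\<omega>. ?f \<omega> * ?g \<omega> \<partial>M) = (\<integral>\<^sup>+\<omega>. ?f \<omega> \<partial>M) * (\<integral>\<^sup>+\<omega>. ?g \<omega> \<partial>M)"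
      by (simp add: UNIV_bool mult.commute comp_def)
    moreover have "?f \<omega> = indicator A \<omega>" if "\<omega> \<in> space M" for \<omega>
    proof -
      have "(\<Sum>i\<in>{i. i < m \<and> fst p \<in> e i}. restrict (\<lambda>i. emeasure (N \<omega>) (E i)) {..<m} i) = emeasure (N \<omega>) (fst p)"
        if "p \<in> I" for p
        using that decomp[of "fst p" \<omega>] \<open>\<omega> \<in> space M\<close> by (simp add: \<F>_def)
      then show ?thesis
        using that by (auto simp: A ev_def Q_def indicator_def split_beta simp del: restrict_apply)
    qed
    moreover have "?g \<omega> = emeasure (N \<omega>) G" for \<omega>
      by (simp add: E_def)
    ultimately show ?case
      using ev_sets[OF I] nn_integral_emeasure_N[OF G(1-3)] by (simp add: A cong: nn_integral_cong)
  next
    case empty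
    show ?case by simp
  next
    case (compl A)
    have [measurable]: "A \<in> sets M"
      using compl(1) \<G>_sets by auto
    have "(\<integral>\<^sup>+\<omega>. indicator A \<omega> * emeasure (N \<omega>) G \<partial>M) + (\<integral>\<^sup>+\<omega>. indicator (space M - A) \<omega> * emeasure (N \<omega>) G \<partial>M)
        = (\<integral>\<^sup>+\<omega>. emeasure (N \<omega>) G \<partial>M)"
      by (subst nn_integral_add[symmetric]) (auto intro!: nn_integral_cong simp: indicator_def)
    also have "\<dots> = (emeasure M A + emeasure M (space M - A)) * emeasure lborel G"
      using emeasure_compl[of A M] nn_integral_emeasure_N[OF G(1-3)]
      by (subst plus_emeasure) (auto simp: emeasure_space_1 Un_absorb1 sets.sets_into_space)
    \<comment> \<open>The contribution of A is cancelled on both sides, which is legitimate because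
      it is finite.\<close>
    finally show ?case
      using compl(2) G_fin by (auto simp: distrib_right ennreal_add_left_cancel ennreal_mult_eq_top_iff)
  next
    case (union A)
    have [measurable]: "A i \<in> sets M" for i
      using union \<G>_sets by auto
    have "(\<integral>\<^sup>+\<omega>. indicator (\<Union>i. A i) \<omega> * emeasure (N \<omega>) G \<partial>M) =
        (\<integral>\<^sup>+\<omega>. (\<Sum>i. indicator (A i) \<omega> * emeasure (N \<omega>) G) \<partial>M)"
      by (intro nn_integral_cong) (simp add: suminf_indicator[OF union(1), symmetric])
    also have "\<dots> = (\<Sum>i. emeasure M (A i) * emeasure lborel G)"
      by (subst nn_integral_suminf) (simp_all add: union)
    also have "\<dots> = emeasure M (\<Union>i. A i) * emeasure lborel G"
      using union(1) by (subst suminf_emeasure[symmetric]) auto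
    finally show ?case .
  qed
qed

end

section \<open>Compensation of predictable sets\<close>

context strip_poisson_process
begin

definition past :: "real \<Rightarrow> 'w measure" where
  "past t = sigma (space M) (pp_filtration M N t)"

lemma space_past [simp]: "space (past t) = space M"
  and sets_past [simp]: "sets (past t) = pp_filtration M N t"
proof -
  have *: "{(\<lambda>\<omega>. emeasure (N \<omega>) F) -` A \<inter> space M | F A.
      F \<in> sets borel \<and> F \<subseteq> strip t \<and> A \<in> sets borel} \<subseteq> Pow (space M)"
    by auto
  have "pp_filtration M N t \<subseteq> Pow (space M)"
    using sigma_sets_into_sp[OF *] unfolding pp_filtration_def by auto
  then show "space (past t) = space M" "sets (past t) = pp_filtration M N t"
    using * by (simp_all add: past_def) (simp add: pp_filtration_def sigma_sets_sigma_sets_eq)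
qed

lemma measurable_emeasure_N_past:
  assumes "F \<in> sets borel" "F \<subseteq> strip t"
  shows "(\<lambda>\<omega>. emeasure (N \<omega>) F) \<in> borel_measurable (past t)"
  by (rule measurableI) (use assms in \<open>auto simp: pp_filtration_def\<close>)

lemma measurable_past_imp:
  assumes "f \<in> measurable (past t) K" "t \<le> T"
  shows "f \<in> measurable M K"
proof (rule measurableI)
  show "f \<omega> \<in> space K" if "\<omega> \<in> space M" for \<omega>
    using measurable_space[OF assms(1)] that by simp
  show "f -` A \<inter> space M \<in> sets M" if "A \<in> sets K" for A
    using measurable_sets[OF assms(1) that] pp_filtration_subset_sets[OF assms(2)] by auto
qed

text \<open>The section of H at \<omega>, seen as a set of time-height points. The strict inequality
  u < t agrees with \<open>counting_process\<close>; the cut at height C makes the section bounded,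
  hence of finite mass.\<close>

definition slice :: "real \<Rightarrow> real \<Rightarrow> ((real \<times> 'w) \<times> real) set \<Rightarrow> 'w \<Rightarrow> (real \<times> real) set" where
  "slice C t H \<omega> = {(u, x). 0 \<le> u \<and> u < t \<and> 0 \<le> x \<and> x \<le> C \<and> ((u, \<omega>), x) \<in> H}"

text \<open>The last clause is the compensation formula for the indicator of H up to time t. The
  measurability clauses travel with it, since the closure properties establish all of them together;
  measurability in \<open>past t\<close> later yields adaptedness of the counting process.\<close>

definition compensated :: "real \<Rightarrow> real \<Rightarrow> ((real \<times> 'w) \<times> real) set \<Rightarrow> bool" where
  "compensated S C H \<longleftrightarrow> (\<forall>t\<in>{0..S}. (\<forall>\<omega>\<in>space M. slice C t H \<omega> \<in> sets borel) \<and>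
     (\<lambda>\<omega>. emeasure (N \<omega>) (slice C t H \<omega>)) \<in> borel_measurable (past t) \<and>
     (\<lambda>\<omega>. emeasure lborel (slice C t H \<omega>)) \<in> borel_measurable M \<and>
     (\<integral>\<^sup>+\<omega>. emeasure (N \<omega>) (slice C t H \<omega>) \<partial>M) = (\<integral>\<^sup>+\<omega>. emeasure lborel (slice C t H \<omega>) \<partial>M))"

lemma bounded_subset_rectangle: "F \<subseteq> {a..b} \<times> {c..d} \<Longrightarrow> bounded (F :: (real \<times> real) set)"
  by (rule bounded_subset[OF bounded_Times]) auto

lemma bounded_slice: "bounded (slice C t H \<omega>)"
  by (rule bounded_subset_rectangle[of _ 0 t 0 C]) (auto simp: slice_def)

lemma slice_subset_strip: "slice C t H \<omega> \<subseteq> strip t"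
  by (auto simp: slice_def strip_def)

lemma emeasure_N_finite:
  assumes "\<omega> \<in> space M" "F \<subseteq> strip T" "bounded F"
  shows "emeasure (N \<omega>) F < \<infinity>"
proof (cases "F \<in> sets borel")
  case True
  then show ?thesis
    by (simp add: emeasure_N_eq_points assms of_nat_less_top)
next
  case False
  then show ?thesis
    using assms sets_N by (simp add: emeasure_notin_sets)
qed

text \<open>Slices are bounded, so both their point count and their Lebesgue measure are finite and
  subtraction is legitimate.\<close>

lemma compensated_Diff:
  assumes "S \<le> T" and H: "compensated S C H\<^sub>1" "compensated S C H\<^sub>2" "H\<^sub>1 \<subseteq> H\<^sub>2"
  shows "compensated S C (H\<^sub>2 - H\<^sub>1)"
  unfolding compensated_def
proof (intro ballI)
  fix t assume t: "t \<in> {0..S}"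
  let ?s\<^sub>1 = "slice C t H\<^sub>1" and ?s\<^sub>2 = "slice C t H\<^sub>2"
  have diff: "slice C t (H\<^sub>2 - H\<^sub>1) \<omega> = ?s\<^sub>2 \<omega> - ?s\<^sub>1 \<omega>" and sub: "?s\<^sub>1 \<omega> \<subseteq> ?s\<^sub>2 \<omega>" for \<omega>
    using H(3) by (auto simp: slice_def)
  have strip: "slice C t H \<omega> \<subseteq> strip T" for H \<omega>
    using slice_subset_strip[of C t H \<omega>] strip_mono[of t T] t assms(1) by auto
  have borel: "?s\<^sub>1 \<omega> \<in> sets borel" "?s\<^sub>2 \<omega> \<in> sets borel" if "\<omega> \<in> space M" for \<omega>
    using H t that by (auto simp: compensated_def)
  have [measurable]: "(\<lambda>\<omega>. emeasure (N \<omega>) (?s\<^sub>1 \<omega>)) \<in> borel_measurable (past t)"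
      "(\<lambda>\<omega>. emeasure (N \<omega>) (?s\<^sub>2 \<omega>)) \<in> borel_measurable (past t)"
      "(\<lambda>\<omega>. emeasure lborel (?s\<^sub>1 \<omega>)) \<in> borel_measurable M"
      "(\<lambda>\<omega>. emeasure lborel (?s\<^sub>2 \<omega>)) \<in> borel_measurable M"
    using H t by (auto simp: compensated_def)
  have [measurable]: "(\<lambda>\<omega>. emeasure (N \<omega>) (?s\<^sub>1 \<omega>)) \<in> borel_measurable M"
      "(\<lambda>\<omega>. emeasure (N \<omega>) (?s\<^sub>2 \<omega>)) \<in> borel_measurable M"
    using t assms(1) by (auto intro!: measurable_past_imp[of _ t])
  have eq: "(\<integral>\<^sup>+\<omega>. emeasure (N \<omega>) (?s\<^sub>1 \<omega>) \<partial>M) = (\<integral>\<^sup>+\<omega>. emeasure lborel (?s\<^sub>1 \<omega>) \<partial>M)"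
      "(\<integral>\<^sup>+\<omega>. emeasure (N \<omega>) (?s\<^sub>2 \<omega>) \<partial>M) = (\<integral>\<^sup>+\<omega>. emeasure lborel (?s\<^sub>2 \<omega>) \<partial>M)"
    using H t by (auto simp: compensated_def)
  have N_diff: "emeasure (N \<omega>) (?s\<^sub>2 \<omega> - ?s\<^sub>1 \<omega>) = emeasure (N \<omega>) (?s\<^sub>2 \<omega>) - emeasure (N \<omega>) (?s\<^sub>1 \<omega>)"
    if "\<omega> \<in> space M" for \<omega>
    by (rule emeasure_Diff)
       (use emeasure_N_finite[OF that strip bounded_slice] borel that strip sub in \<open>auto simp: sets_N less_top\<close>)
  have L_diff: "emeasure lborel (?s\<^sub>2 \<omega> - ?s\<^sub>1 \<omega>) = emeasure lborel (?s\<^sub>2 \<omega>) - emeasure lborel (?s\<^sub>1 \<omega>)"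
    if "\<omega> \<in> space M" for \<omega>
    by (rule emeasure_Diff)
       (use emeasure_bounded_finite[OF bounded_slice] borel that sub in \<open>auto simp: less_top\<close>)
  have "(\<integral>\<^sup>+\<omega>. emeasure lborel (?s\<^sub>1 \<omega>) \<partial>M) \<le> (\<integral>\<^sup>+\<omega>. emeasure lborel ({0..t} \<times> {0..C}) \<partial>M)"
    by (intro nn_integral_mono emeasure_mono) (auto simp: slice_def intro!: borel_Times)
  also have "\<dots> < \<infinity>"
    using emeasure_bounded_finite[OF bounded_subset_rectangle[OF subset_refl, of 0 t 0 C]]
    by (simp add: emeasure_space_1)
  finally have fin: "(\<integral>\<^sup>+\<omega>. emeasure lborel (?s\<^sub>1 \<omega>) \<partial>M) \<noteq> \<infinity>"
    by simp
  have N_sub: "emeasure (N \<omega>) (?s\<^sub>1 \<omega>) \<le> emeasure (N \<omega>) (?s\<^sub>2 \<omega>)" if "\<omega> \<in> space M" for \<omega>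
    using that borel strip sub by (intro emeasure_mono) (auto simp: sets_N)
  have L_sub: "emeasure lborel (?s\<^sub>1 \<omega>) \<le> emeasure lborel (?s\<^sub>2 \<omega>)" if "\<omega> \<in> space M" for \<omega>
    using that borel sub by (intro emeasure_mono) auto
  have "(\<integral>\<^sup>+\<omega>. emeasure (N \<omega>) (?s\<^sub>2 \<omega> - ?s\<^sub>1 \<omega>) \<partial>M) = (\<integral>\<^sup>+\<omega>. emeasure lborel (?s\<^sub>2 \<omega> - ?s\<^sub>1 \<omega>) \<partial>M)"
    using fin eq N_sub L_sub by (simp add: N_diff L_diff nn_integral_diff cong: nn_integral_cong)
  moreover have "(\<lambda>\<omega>. emeasure (N \<omega>) (?s\<^sub>2 \<omega> - ?s\<^sub>1 \<omega>)) \<in> borel_measurable (past t)"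
    by (subst measurable_cong[OF N_diff]) auto
  moreover have "(\<lambda>\<omega>. emeasure lborel (?s\<^sub>2 \<omega> - ?s\<^sub>1 \<omega>)) \<in> borel_measurable M"
    by (subst measurable_cong[OF L_diff]) auto
  ultimately show "(\<forall>\<omega>\<in>space M. slice C t (H\<^sub>2 - H\<^sub>1) \<omega> \<in> sets borel) \<and>
     (\<lambda>\<omega>. emeasure (N \<omega>) (slice C t (H\<^sub>2 - H\<^sub>1) \<omega>)) \<in> borel_measurable (past t) \<and>
     (\<lambda>\<omega>. emeasure lborel (slice C t (H\<^sub>2 - H\<^sub>1) \<omega>)) \<in> borel_measurable M \<and>
     (\<integral>\<^sup>+\<omega>. emeasure (N \<omega>) (slice C t (H\<^sub>2 - H\<^sub>1) \<omega>) \<partial>M) =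
       (\<integral>\<^sup>+\<omega>. emeasure lborel (slice C t (H\<^sub>2 - H\<^sub>1) \<omega>) \<partial>M)"
    using borel unfolding diff by auto
qed

lemma compensated_UN:
  assumes "S \<le> T" and H: "\<And>i::nat. compensated S C (H i)" and disj: "disjoint_family H"
  shows "compensated S C (\<Union>i. H i)"
  unfolding compensated_def
proof (intro ballI)
  fix t assume t: "t \<in> {0..S}"
  have UN: "slice C t (\<Union>i. H i) \<omega> = (\<Union>i. slice C t (H i) \<omega>)" for \<omega>
    by (auto simp: slice_def)
  have dis: "disjoint_family (\<lambda>i. slice C t (H i) \<omega>)" for \<omega>
    using disj by (fastforce simp: slice_def disjoint_family_on_def)
  have strip: "slice C t H \<omega> \<subseteq> strip T" for H \<omega>
    using slice_subset_strip[of C t H \<omega>] strip_mono[of t T] t assms(1) by auto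
  have borel: "slice C t (H i) \<omega> \<in> sets borel" if "\<omega> \<in> space M" for \<omega> i
    using H[of i] t that by (auto simp: compensated_def)
  have [measurable]: "(\<lambda>\<omega>. emeasure (N \<omega>) (slice C t (H i) \<omega>)) \<in> borel_measurable (past t)"
      "(\<lambda>\<omega>. emeasure lborel (slice C t (H i) \<omega>)) \<in> borel_measurable M" for i
    using H[of i] t by (auto simp: compensated_def)
  have [measurable]: "(\<lambda>\<omega>. emeasure (N \<omega>) (slice C t (H i) \<omega>)) \<in> borel_measurable M" for i
    using t assms(1) by (auto intro!: measurable_past_imp[of _ t])
  have N_UN: "emeasure (N \<omega>) (\<Union>i. slice C t (H i) \<omega>) = (\<Sum>i. emeasure (N \<omega>) (slice C t (H i) \<omega>))"
    if "\<omega> \<in> space M" for \<omega>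
    by (rule suminf_emeasure[symmetric]) (use dis borel that strip in \<open>auto simp: sets_N\<close>)
  have L_UN: "emeasure lborel (\<Union>i. slice C t (H i) \<omega>) = (\<Sum>i. emeasure lborel (slice C t (H i) \<omega>))"
    if "\<omega> \<in> space M" for \<omega>
    by (rule suminf_emeasure[symmetric]) (use dis borel that in auto)
  have "(\<integral>\<^sup>+\<omega>. emeasure (N \<omega>) (\<Union>i. slice C t (H i) \<omega>) \<partial>M) =
      (\<integral>\<^sup>+\<omega>. emeasure lborel (\<Union>i. slice C t (H i) \<omega>) \<partial>M)"
    using H t by (simp add: N_UN L_UN nn_integral_suminf compensated_def cong: nn_integral_cong)
  moreover have "(\<lambda>\<omega>. emeasure (N \<omega>) (\<Union>i. slice C t (H i) \<omega>)) \<in> borel_measurable (past t)"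
    by (subst measurable_cong[OF N_UN]) auto
  moreover have "(\<lambda>\<omega>. emeasure lborel (\<Union>i. slice C t (H i) \<omega>)) \<in> borel_measurable M"
    by (subst measurable_cong[OF L_UN]) auto
  ultimately show "(\<forall>\<omega>\<in>space M. slice C t (\<Union>i. H i) \<omega> \<in> sets borel) \<and>
     (\<lambda>\<omega>. emeasure (N \<omega>) (slice C t (\<Union>i. H i) \<omega>)) \<in> borel_measurable (past t) \<and>
     (\<lambda>\<omega>. emeasure lborel (slice C t (\<Union>i. H i) \<omega>)) \<in> borel_measurable M \<and>
     (\<integral>\<^sup>+\<omega>. emeasure (N \<omega>) (slice C t (\<Union>i. H i) \<omega>) \<partial>M) =
       (\<integral>\<^sup>+\<omega>. emeasure lborel (slice C t (\<Union>i. H i) \<omega>) \<partial>M)"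
    using borel unfolding UN by auto
qed

lemma compensated_empty: "compensated S C {}"
  by (auto simp: compensated_def slice_def)

text \<open>The slice is a deterministic region F strictly after time s, switched on by an event A
  known at time s, so \<open>past_independent_of_future\<close> applies.\<close>

lemma compensated_future_rectangle:
  assumes "S \<le> T" and A: "A \<in> pp_filtration M N s" and [measurable]: "b \<in> sets borel"
    and s: "0 \<le> s" "s \<le> S"
  shows "compensated S C (({s<..r} \<times> A) \<times> b)"
  unfolding compensated_def
proof (intro ballI)
  fix t assume t: "t \<in> {0..S}"
  define F where "F = ({s<..r} \<inter> {0..<t}) \<times> ({0..C} \<inter> b)"
  have F: "F \<in> sets borel" "F \<subseteq> strip t" "F \<subseteq> strip T" "bounded F" "F \<inter> strip s = {}"
    using t assms(1) by (auto simp: F_def strip_def intro!: borel_Times bounded_subset_rectangle[of _ 0 t 0 C])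
  have slice: "slice C t (({s<..r} \<times> A) \<times> b) \<omega> = (if \<omega> \<in> A then F else {})" for \<omega>
    by (auto simp: slice_def F_def)
  have ind: "emeasure K (if \<omega> \<in> A then F else {}) = indicator A \<omega> * emeasure K F" for K \<omega>
    by auto
  have A_M[measurable]: "A \<in> sets M"
    using A pp_filtration_subset_sets[of s] s assms(1) by auto
  have meas: "(\<lambda>\<omega>. indicator A \<omega> * emeasure (N \<omega>) F) \<in> borel_measurable (past t)"
  \<comment> \<open>If s < t then A already belongs to the past of t; otherwise the region before t
    is empty and A does not matter.\<close>
  proof (cases "s < t")
    case True
    then have [measurable]: "A \<in> sets (past t)"
      using A pp_filtration_mono[of s t] by auto
    have [measurable]: "(\<lambda>\<omega>. emeasure (N \<omega>) F) \<in> borel_measurable (past t)"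
      by (rule measurable_emeasure_N_past[OF F(1,2)])
    show ?thesis
      by measurable
  next
    case False
    then have "F = {}"
      by (auto simp: F_def)
    then show ?thesis
      by simp
  qed
  have "(\<integral>\<^sup>+\<omega>. indicator A \<omega> * emeasure (N \<omega>) F \<partial>M) = (\<integral>\<^sup>+\<omega>. indicator A \<omega> * emeasure lborel F \<partial>M)"
    using past_independent_of_future[OF _ A F(1,3,4,5)] s assms(1)
    by (simp add: nn_integral_multc)
  then show "(\<forall>\<omega>\<in>space M. slice C t (({s<..r} \<times> A) \<times> b) \<omega> \<in> sets borel) \<and>
     (\<lambda>\<omega>. emeasure (N \<omega>) (slice C t (({s<..r} \<times> A) \<times> b) \<omega>)) \<in> borel_measurable (past t) \<and>
     (\<lambda>\<omega>. emeasure lborel (slice C t (({s<..r} \<times> A) \<times> b) \<omega>)) \<in> borel_measurable M \<and>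
     (\<integral>\<^sup>+\<omega>. emeasure (N \<omega>) (slice C t (({s<..r} \<times> A) \<times> b) \<omega>) \<partial>M) =
       (\<integral>\<^sup>+\<omega>. emeasure lborel (slice C t (({s<..r} \<times> A) \<times> b) \<omega>) \<partial>M)"
    using meas F(1) unfolding slice ind by auto
qed

text \<open>Complements in the generation argument are taken in
  \<open>{0..S} \<times> space M\<close>. This set contains time 0, which no half-open generating
  rectangle does, so it is treated separately.\<close>

lemma compensated_deterministic:
  assumes "S \<le> T" and [measurable]: "b \<in> sets borel"
  shows "compensated S C (({0..S} \<times> space M) \<times> b)"
  unfolding compensated_def
proof (intro ballI)
  fix t assume t: "t \<in> {0..S}"
  define F where "F = {0..<t} \<times> ({0..C} \<inter> b)"
  have F: "F \<in> sets borel" "F \<subseteq> strip t" "F \<subseteq> strip T" "bounded F"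
    using t assms(1) by (auto simp: F_def strip_def intro!: borel_Times bounded_subset_rectangle[of _ 0 t 0 C])
  have slice: "slice C t (({0..S} \<times> space M) \<times> b) \<omega> = F" if "\<omega> \<in> space M" for \<omega>
    using that t by (auto simp: slice_def F_def)
  have "(\<lambda>\<omega>. emeasure (N \<omega>) (slice C t (({0..S} \<times> space M) \<times> b) \<omega>)) \<in> borel_measurable (past t)"
    by (subst measurable_cong[of _ _ "\<lambda>\<omega>. emeasure (N \<omega>) F"])
       (simp_all add: slice measurable_emeasure_N_past[OF F(1,2)])
  moreover have "(\<lambda>\<omega>. emeasure lborel (slice C t (({0..S} \<times> space M) \<times> b) \<omega>)) \<in> borel_measurable M"
    by (subst measurable_cong[of _ _ "\<lambda>\<omega>. emeasure lborel F"]) (simp_all add: slice)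
  moreover have "(\<integral>\<^sup>+\<omega>. emeasure (N \<omega>) (slice C t (({0..S} \<times> space M) \<times> b) \<omega>) \<partial>M) =
       (\<integral>\<^sup>+\<omega>. emeasure lborel (slice C t (({0..S} \<times> space M) \<times> b) \<omega>) \<partial>M)"
    using nn_integral_emeasure_N[OF F(1,3,4)]
    by (simp add: slice emeasure_space_1 cong: nn_integral_cong)
  ultimately show "(\<forall>\<omega>\<in>space M. slice C t (({0..S} \<times> space M) \<times> b) \<omega> \<in> sets borel) \<and>
     (\<lambda>\<omega>. emeasure (N \<omega>) (slice C t (({0..S} \<times> space M) \<times> b) \<omega>)) \<in> borel_measurable (past t) \<and>
     (\<lambda>\<omega>. emeasure lborel (slice C t (({0..S} \<times> space M) \<times> b) \<omega>)) \<in> borel_measurable M \<and>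
     (\<integral>\<^sup>+\<omega>. emeasure (N \<omega>) (slice C t (({0..S} \<times> space M) \<times> b) \<omega>) \<partial>M) =
       (\<integral>\<^sup>+\<omega>. emeasure lborel (slice C t (({0..S} \<times> space M) \<times> b) \<omega>) \<partial>M)"
    using slice F(1) by auto
qed

section \<open>From generating rectangles to all predictable sets\<close>

abbreviation pred_rectangles :: "real \<Rightarrow> (real \<times> 'w) set set" where
  "pred_rectangles S \<equiv>
    {{s<..t} \<times> A | s t A. 0 \<le> s \<and> s \<le> t \<and> t \<le> S \<and> A \<in> pp_filtration M N s}"

lemma pred_rectangles_closed: "pred_rectangles S \<subseteq> Pow ({0..S} \<times> space M)"
proof safe
  fix a \<omega> s t A
  assume "A \<in> pp_filtration M N s" "\<omega> \<in> A"
  then show "\<omega> \<in> space M"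
    using sets.sets_into_space[of A "past s"] by auto
qed auto

lemma space_predictable [simp]: "space (predictable_algebra M N S) = {0..S} \<times> space M"
  and sets_predictable: "sets (predictable_algebra M N S) = sigma_sets ({0..S} \<times> space M) (pred_rectangles S)"
  unfolding predictable_algebra_def
  by (rule space_measure_of[OF pred_rectangles_closed], rule sets_measure_of[OF pred_rectangles_closed])

lemma Int_stable_pred_rectangles: "Int_stable (pred_rectangles S)"
proof (rule Int_stableI)
  fix a b assume "a \<in> pred_rectangles S" "b \<in> pred_rectangles S"
  then obtain s t A s' t' A' where a: "a = {s<..t} \<times> A" "0 \<le> s" "s \<le> t" "t \<le> S" "A \<in> pp_filtration M N s"
    and b: "b = {s'<..t'} \<times> A'" "0 \<le> s'" "s' \<le> t'" "t' \<le> S" "A' \<in> pp_filtration M N s'"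
    by blast
  let ?s = "max s s'"
  have "A \<in> sets (past ?s)" "A' \<in> sets (past ?s)"
    using a b pp_filtration_mono[of s ?s] pp_filtration_mono[of s' ?s] by auto
  then have "A \<inter> A' \<in> sets (past ?s)"
    by (rule sets.Int)
  \<comment> \<open>The outer maximum keeps the endpoints ordered when the two time intervals are
    disjoint; the interval is then empty.\<close>
  moreover have "a \<inter> b = {?s<..max ?s (min t t')} \<times> (A \<inter> A')"
    using a(1) b(1) by auto
  moreover have "0 \<le> ?s" "?s \<le> max ?s (min t t')" "max ?s (min t t') \<le> S"
    using a b by auto
  ultimately show "a \<inter> b \<in> pred_rectangles S"
    unfolding sets_past by blast
qed

text \<open>Two Dynkin arguments are nested: the inner one extends from generating rectangles to all
  predictable D with the Borel set b of heights fixed, the outer one from products of D and b to the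
  product sigma-algebra.\<close>

lemma compensated_predictable:
  assumes "S \<le> T" and "H \<in> sets (predictable_algebra M N S \<Otimes>\<^sub>M borel)"
  shows "compensated S C H"
proof -
  have rect: "compensated S C (D \<times> b)" if "D \<in> sets (predictable_algebra M N S)" and b: "b \<in> sets borel" for D b
    using Int_stable_pred_rectangles pred_rectangles_closed that(1)[unfolded sets_predictable]
  proof (induction rule: sigma_sets_induct_disjoint)
    case (basic A)
    then show ?case
      using compensated_future_rectangle[OF assms(1) _ b] by force
  next
    case empty
    show ?case
      by (simp add: compensated_empty)
  next
    case (compl A)
    have "A \<subseteq> {0..S} \<times> space M"
      using sigma_sets_into_sp[OF pred_rectangles_closed compl(1)] .
    then have "compensated S C ((({0..S} \<times> space M) \<times> b) - A \<times> b)"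
      by (intro compensated_Diff compensated_deterministic assms(1) b compl) auto
    moreover have "(({0..S} \<times> space M) \<times> b) - A \<times> b = ({0..S} \<times> space M - A) \<times> b"
      by auto
    ultimately show ?case
      by simp
  next
    case (union A)
    have "compensated S C (\<Union>i. A i \<times> b)"
      by (rule compensated_UN[OF assms(1)]) (use union in \<open>auto simp: disjoint_family_on_def\<close>)
    moreover have "(\<Union>i. A i \<times> b) = (\<Union>i. A i) \<times> b"
      by auto
    ultimately show ?case
      by simp
  qed
  show ?thesis
    using Int_stable_pair_measure_generator pair_measure_closed assms(2)[unfolded sets_pair_measure]
  proof (induction rule: sigma_sets_induct_disjoint)
    case (basic A)
    then show ?case
      using rect by auto
  next
    case empty
    show ?case
      by (rule compensated_empty)
  next
    case (compl A)
    have "A \<subseteq> space (predictable_algebra M N S) \<times> space borel"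
      using sigma_sets_into_sp[OF pair_measure_closed compl(1)] .
    then show ?case
      using compensated_deterministic[OF assms(1), of UNIV] compl
      by (intro compensated_Diff assms(1)) auto
  next
    case (union A)
    then show ?case
      by (intro compensated_UN assms(1)) auto
  qed
qed

end

section \<open>Counting processes with bounded predictable intensity\<close>

locale strip_intensity = strip_poisson_process +
  fixes S C :: real and \<nu> :: "real \<Rightarrow> 'a \<Rightarrow> real"
  assumes S: "0 \<le> S" "S \<le> T"
    and predictable: "(\<lambda>(t, \<omega>). \<nu> t \<omega>) \<in> borel_measurable (predictable_algebra M N S)"
    and \<nu>_nonneg: "\<And>t \<omega>. t \<in> {0..S} \<Longrightarrow> \<omega> \<in> space M \<Longrightarrow> 0 \<le> \<nu> t \<omega>"
    and \<nu>_le: "\<And>t \<omega>. t \<in> {0..S} \<Longrightarrow> \<omega> \<in> space M \<Longrightarrow> \<nu> t \<omega> \<le> C"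
begin

abbreviation X :: "real \<Rightarrow> 'a \<Rightarrow> nat" where
  "X \<equiv> counting_process N \<nu>"

lemma C_nonneg: "0 \<le> C"
proof -
  obtain \<omega> where "\<omega> \<in> space M"
    using not_empty by auto
  then show ?thesis
    using \<nu>_nonneg[of 0 \<omega>] \<nu>_le[of 0 \<omega>] S by auto
qed

text \<open>The region under the graph of \<nu>, as a predictable set with an additional height
  coordinate. Its slice up to t is the region counted by \<open>X t\<close>, which makes the
  compensation formula applicable to the process.\<close>

definition hypograph :: "((real \<times> 'a) \<times> real) set" where
  "hypograph = {((u, \<omega>), x). u \<in> {0..S} \<and> \<omega> \<in> space M \<and> x \<le> \<nu> u \<omega>}"

lemma hypograph_sets: "hypograph \<in> sets (predictable_algebra M N S \<Otimes>\<^sub>M borel)"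
proof -
  note [measurable] = predictable
  have "{p \<in> space (predictable_algebra M N S \<Otimes>\<^sub>M borel). snd p \<le> (case fst p of (t, \<omega>) \<Rightarrow> \<nu> t \<omega>)}
      \<in> sets (predictable_algebra M N S \<Otimes>\<^sub>M borel)"
    by measurable
  also have "{p \<in> space (predictable_algebra M N S \<Otimes>\<^sub>M borel). snd p \<le> (case fst p of (t, \<omega>) \<Rightarrow> \<nu> t \<omega>)} = hypograph"
    by (auto simp: space_pair_measure hypograph_def)
  finally show ?thesis .
qed

lemma slice_hypograph:
  assumes "\<omega> \<in> space M" "t \<in> {0..S}"
  shows "slice C t hypograph \<omega> = {(s, x) \<in> strip t. s < t \<and> x \<le> \<nu> s \<omega>}"
proof -
  have "x \<le> C" if "0 \<le> u" "u < t" "x \<le> \<nu> u \<omega>" for u x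
    using \<nu>_le[of u \<omega>] assms that by simp
  then show ?thesis
    using assms unfolding slice_def hypograph_def strip_def by auto
qed

lemma counting_process_eq_points:
  "\<omega> \<in> space M \<Longrightarrow> t \<in> {0..S} \<Longrightarrow> X t \<omega> = points (slice C t hypograph \<omega>) \<omega>"
  by (simp add: slice_hypograph counting_process_def points_def)

lemma slice_strip_T: "t \<in> {0..S} \<Longrightarrow> slice C t H \<omega> \<subseteq> strip T"
  using slice_subset_strip[of C t H \<omega>] strip_mono[of t T] S by auto

lemma slice_borel:
  assumes "\<omega> \<in> space M" "t \<in> {0..S}" "H \<in> sets (predictable_algebra M N S \<Otimes>\<^sub>M borel)"
  shows "slice C t H \<omega> \<in> sets borel"
  using compensated_predictable[OF S(2) assms(3), of C] assms by (auto simp: compensated_def)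

lemma of_nat_counting_process:
  assumes "\<omega> \<in> space M" "t \<in> {0..S}"
  shows "emeasure (N \<omega>) (slice C t hypograph \<omega>) = of_nat (X t \<omega>)"
  using emeasure_N_eq_points[OF assms(1) slice_borel[OF assms hypograph_sets] slice_strip_T[OF assms(2)] bounded_slice]
  by (simp add: counting_process_eq_points[OF assms])

lemma counting_process_adapted:
  assumes "t \<in> {0..S}"
  shows "X t \<in> measurable (past t) (count_space UNIV)"
proof -
  have [measurable]: "(\<lambda>\<omega>. emeasure (N \<omega>) (slice C t hypograph \<omega>)) \<in> borel_measurable (past t)"
    using compensated_predictable[OF S(2) hypograph_sets, of C] assms by (auto simp: compensated_def)
  have "(\<lambda>\<omega>. nat \<lfloor>enn2real (emeasure (N \<omega>) (slice C t hypograph \<omega>))\<rfloor>) \<in> measurable (past t) (count_space UNIV)"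
    by measurable
  then show ?thesis
    by (rule measurable_cong[THEN iffD1, rotated]) (use assms in \<open>simp add: of_nat_counting_process\<close>)
qed

lemma counting_process_measurable:
  "t \<in> {0..S} \<Longrightarrow> X t \<in> measurable M (count_space UNIV)"
  using counting_process_adapted[of t] S by (intro measurable_past_imp[of _ t]) auto

lemma counting_process_0: "X 0 \<omega> = 0"
proof -
  have "{(s, x) \<in> strip 0. s < 0 \<and> x \<le> \<nu> s \<omega>} = {}"
    by (auto simp: strip_def)
  then show ?thesis
    unfolding counting_process_def by (simp only: measure_empty) simp
qed

text \<open>The rectangle is deterministic: whatever \<nu> is, the number of jumps in a step is
  dominated by a Poisson variable of mean C(t-s).\<close>

lemma increment_bounds:
  assumes "\<omega> \<in> space M" "0 \<le> s" "s \<le> t" "t \<le> S"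
  shows "X s \<omega> \<le> X t \<omega>" "X t \<omega> \<le> X s \<omega> + points ({s..t} \<times> {0..C}) \<omega>"
proof -
  let ?R = "{s..t} \<times> {0..C}"
  have R: "?R \<in> sets borel" "?R \<subseteq> strip T" "bounded ?R"
    using assms S by (auto simp: strip_def intro!: borel_Times bounded_subset_rectangle)
  have st: "s \<in> {0..S}" "t \<in> {0..S}"
    using assms by auto
  note sets = slice_borel[OF assms(1) st(1) hypograph_sets] slice_borel[OF assms(1) st(2) hypograph_sets]
    slice_strip_T[OF st(1), of hypograph \<omega>] slice_strip_T[OF st(2), of hypograph \<omega>]
  have "emeasure (N \<omega>) (slice C s hypograph \<omega>) \<le> emeasure (N \<omega>) (slice C t hypograph \<omega>)"
    using assms sets by (intro emeasure_mono) (auto simp: slice_def sets_N)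
  then show "X s \<omega> \<le> X t \<omega>"
    unfolding of_nat_counting_process[OF assms(1) st(1)] of_nat_counting_process[OF assms(1) st(2)] of_nat_le_iff .
  have "emeasure (N \<omega>) (slice C t hypograph \<omega>) \<le> emeasure (N \<omega>) (slice C s hypograph \<omega> \<union> ?R)"
    using assms sets R by (intro emeasure_mono) (auto simp: slice_def sets_N)
  also have "\<dots> \<le> emeasure (N \<omega>) (slice C s hypograph \<omega>) + emeasure (N \<omega>) ?R"
    using assms sets R by (intro emeasure_subadditive) (auto simp: sets_N)
  also have "\<dots> = of_nat (X s \<omega> + points ?R \<omega>)"
    unfolding of_nat_counting_process[OF assms(1) st(1)] emeasure_N_eq_points[OF assms(1) R] by simp
  finally show "X t \<omega> \<le> X s \<omega> + points ?R \<omega>"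
    unfolding of_nat_counting_process[OF assms(1) st(2)] of_nat_le_iff .
qed

text \<open>The counting process uses the closed-open interval from \<open>s\<close> to \<open>t\<close>, predictable rectangles
  are open at \<open>s\<close>; the difference lies on the vertical line over \<open>s\<close>, which a.s. carries no point.\<close>

lemma nn_integral_increment:
  assumes A: "A \<in> pp_filtration M N s" and s: "0 \<le> s" "s \<le> t" "t \<le> S"
  shows "(\<integral>\<^sup>+\<omega>. indicator A \<omega> * of_nat (X t \<omega> - X s \<omega>) \<partial>M) =
    (\<integral>\<^sup>+\<omega>. indicator A \<omega> * (\<integral>\<^sup>+u. indicator {s<..<t} u * ennreal (\<nu> u \<omega>) \<partial>lborel) \<partial>M)"
proof -
  \<comment> \<open>Restricting to A and to times after s keeps the set predictable because A is
    known at time s. Its slice is the region under \<nu> over the open interval, present on A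
    only.\<close>
  let ?H = "hypograph \<inter> (({s<..t} \<times> A) \<times> UNIV)"
  let ?E = "\<lambda>\<omega>. {(u, x). s < u \<and> u < t \<and> 0 \<le> x \<and> x \<le> \<nu> u \<omega>}"
  have st: "s \<in> {0..S}" "t \<in> {0..S}"
    using s by auto
  have "{s<..t} \<times> A \<in> sets (predictable_algebra M N S)"
    unfolding sets_predictable using A s by (intro sigma_sets.Basic) blast
  then have H: "?H \<in> sets (predictable_algebra M N S \<Otimes>\<^sub>M borel)"
    using hypograph_sets by auto
  have A_space: "A \<subseteq> space M"
    using A sets.sets_into_space[of A "past s"] by auto
  have slice: "slice C t ?H \<omega> = (if \<omega> \<in> A then ?E \<omega> else {})" if "\<omega> \<in> space M" for \<omega>
  proof -
    have "x \<le> C" if "s < u" "u < t" "x \<le> \<nu> u \<omega>" for u x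
      using \<nu>_le[of u \<omega>] \<open>\<omega> \<in> space M\<close> s that by simp
    then show ?thesis
      using that s unfolding slice_def hypograph_def by auto
  qed
  have E_borel: "?E \<omega> \<in> sets borel" if "\<omega> \<in> A" for \<omega>
  proof -
    have "\<omega> \<in> space M"
      using that A_space by auto
    from slice_borel[OF this st(2) H] slice[OF this] that show ?thesis
      by simp
  qed
  let ?Z = "{s} \<times> {0..C}"
  have Z: "?Z \<in> sets borel" "?Z \<subseteq> strip T" "bounded ?Z"
    using s S by (auto simp: strip_def intro!: borel_Times bounded_Times)
  have "(\<integral>\<^sup>+\<omega>. emeasure (N \<omega>) ?Z \<partial>M) = 0"
    unfolding nn_integral_emeasure_N[OF Z] lborel_prod[symmetric]
    by (subst lborel.emeasure_pair_measure_Times) auto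
  then have "AE \<omega> in M. emeasure (N \<omega>) ?Z = 0"
    by (simp add: nn_integral_0_iff_AE measurable_emeasure_N[OF Z(1,2)])
  then have "AE \<omega> in M. indicator A \<omega> * of_nat (X t \<omega> - X s \<omega>) = emeasure (N \<omega>) (slice C t ?H \<omega>)"
    using AE_space
  proof eventually_elim
    case (elim \<omega>)
    show ?case
    proof (cases "\<omega> \<in> A")
      case False
      then show ?thesis
        using elim by (simp add: slice)
    next
      case True
      note sets = slice_borel[OF elim(2) st(1) hypograph_sets] slice_borel[OF elim(2) st(2) hypograph_sets]
        slice_strip_T[OF st(1), of hypograph \<omega>] slice_strip_T[OF st(2), of hypograph \<omega>] E_borel[OF True]
      have E_strip: "?E \<omega> \<subseteq> strip T"
        using s S by (auto simp: strip_def)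
      have N_sets: "slice C s hypograph \<omega> \<in> sets (N \<omega>)" "slice C t hypograph \<omega> \<in> sets (N \<omega>)"
          "?E \<omega> \<in> sets (N \<omega>)" "?Z \<in> sets (N \<omega>)"
        unfolding sets_N[OF elim(2)] using sets E_strip Z by blast+
      note N_sets' = sets.Un[OF N_sets(1,3)] sets.Un[OF sets.Un[OF N_sets(1,3)] N_sets(4)]
      have "slice C s hypograph \<omega> \<inter> ?E \<omega> = {}"
        by (auto simp: slice_def)
      then have "emeasure (N \<omega>) (slice C s hypograph \<omega> \<union> ?E \<omega>) = of_nat (X s \<omega>) + emeasure (N \<omega>) (?E \<omega>)"
        unfolding of_nat_counting_process[OF elim(2) st(1), symmetric]
        by (intro plus_emeasure[symmetric]) (rule N_sets)+
      moreover have "emeasure (N \<omega>) (slice C t hypograph \<omega>) = emeasure (N \<omega>) (slice C s hypograph \<omega> \<union> ?E \<omega>)"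
      proof (rule antisym)
        have "emeasure (N \<omega>) (slice C t hypograph \<omega>) \<le> emeasure (N \<omega>) ((slice C s hypograph \<omega> \<union> ?E \<omega>) \<union> ?Z)"
        proof (rule emeasure_mono)
          show "slice C t hypograph \<omega> \<subseteq> slice C s hypograph \<omega> \<union> ?E \<omega> \<union> ?Z"
            by (auto simp: slice_def hypograph_def)
        qed (rule N_sets')
        also have "\<dots> \<le> emeasure (N \<omega>) (slice C s hypograph \<omega> \<union> ?E \<omega>) + emeasure (N \<omega>) ?Z"
          by (rule emeasure_subadditive[OF N_sets'(1) N_sets(4)])
        finally show "emeasure (N \<omega>) (slice C t hypograph \<omega>) \<le> emeasure (N \<omega>) (slice C s hypograph \<omega> \<union> ?E \<omega>)"
          using elim by simp
        show "emeasure (N \<omega>) (slice C s hypograph \<omega> \<union> ?E \<omega>) \<le> emeasure (N \<omega>) (slice C t hypograph \<omega>)"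
        proof (rule emeasure_mono)
          have "\<nu> u \<omega> \<le> C" if "s < u" "u < t" for u
            using \<nu>_le[OF _ elim(2), of u] that s by simp
          then show "slice C s hypograph \<omega> \<union> ?E \<omega> \<subseteq> slice C t hypograph \<omega>"
            using s elim(2) unfolding slice_def hypograph_def by (auto intro: order_trans)
        qed (rule N_sets)
      qed
      ultimately have "of_nat (X t \<omega>) = of_nat (X s \<omega>) + emeasure (N \<omega>) (?E \<omega>)"
        unfolding of_nat_counting_process[OF elim(2) st(2)] by simp
      moreover have "(of_nat (X t \<omega>) :: ennreal) = of_nat (X s \<omega>) + of_nat (X t \<omega> - X s \<omega>)"
        using increment_bounds(1)[OF elim(2) s] by (simp flip: of_nat_add)
      ultimately have "(of_nat (X t \<omega> - X s \<omega>) :: ennreal) = emeasure (N \<omega>) (?E \<omega>)"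
        by (simp add: ennreal_add_left_cancel)
      then show ?thesis
        using True elim by (simp add: slice)
    qed
  qed
  then have "(\<integral>\<^sup>+\<omega>. indicator A \<omega> * of_nat (X t \<omega> - X s \<omega>) \<partial>M) = (\<integral>\<^sup>+\<omega>. emeasure (N \<omega>) (slice C t ?H \<omega>) \<partial>M)"
    by (rule nn_integral_cong_AE)
  also have "\<dots> = (\<integral>\<^sup>+\<omega>. emeasure lborel (slice C t ?H \<omega>) \<partial>M)"
    using compensated_predictable[OF S(2) H, of C] st by (auto simp: compensated_def)
  also have "\<dots> = (\<integral>\<^sup>+\<omega>. indicator A \<omega> * (\<integral>\<^sup>+u. indicator {s<..<t} u * ennreal (\<nu> u \<omega>) \<partial>lborel) \<partial>M)"
  proof (rule nn_integral_cong)
    fix \<omega> assume \<omega>: "\<omega> \<in> space M"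
    have "emeasure lborel (?E \<omega>) = (\<integral>\<^sup>+u. indicator {s<..<t} u * ennreal (\<nu> u \<omega>) \<partial>lborel)" if "\<omega> \<in> A"
    proof -
      have "?E \<omega> \<in> sets (lborel \<Otimes>\<^sub>M lborel)"
        using E_borel[OF that] unfolding lborel_prod by simp
      then have "emeasure (lborel \<Otimes>\<^sub>M lborel) (?E \<omega>) = (\<integral>\<^sup>+u. emeasure lborel (Pair u -` ?E \<omega>) \<partial>lborel)"
        by (rule lborel.emeasure_pair_measure_alt)
      also have "\<dots> = (\<integral>\<^sup>+u. indicator {s<..<t} u * ennreal (\<nu> u \<omega>) \<partial>lborel)"
      proof (rule nn_integral_cong)
        fix u :: real
        show "emeasure lborel (Pair u -` ?E \<omega>) = indicator {s<..<t} u * ennreal (\<nu> u \<omega>)"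
        proof (cases "s < u \<and> u < t")
          case True
          then have "Pair u -` ?E \<omega> = {0..\<nu> u \<omega>}"
            by auto
          then show ?thesis
            using True \<nu>_nonneg[of u \<omega>] \<omega> s by simp
        next
          case False
          then have empty: "Pair u -` ?E \<omega> = {}"
            by auto
          show ?thesis
            unfolding empty using False by simp
        qed
      qed
      finally show ?thesis
        by (simp add: lborel_prod)
    qed
    then show "emeasure lborel (slice C t ?H \<omega>) =
        indicator A \<omega> * (\<integral>\<^sup>+u. indicator {s<..<t} u * ennreal (\<nu> u \<omega>) \<partial>lborel)"
      using \<omega> by (simp add: slice)
  qed
  finally show ?thesis .
qed

text \<open>Each generating rectangle is a product of a Borel set and an event of M, so
  predictability implies joint measurability. The indicator is there because nothing is assumed
  about \<nu> outside \<open>{0..S}\<close>.\<close>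

lemma measurable_intensity:
  "(\<lambda>(u, \<omega>). indicator {0..S} u * \<nu> u \<omega>) \<in> borel_measurable (borel \<Otimes>\<^sub>M M)"
proof -
  let ?R = "restrict_space (borel \<Otimes>\<^sub>M M) ({0..S} \<times> space M)"
  have rect: "{0..S} \<times> space M \<in> sets (borel \<Otimes>\<^sub>M M)"
    by auto
  have "sets (predictable_algebra M N S) \<subseteq> sets ?R"
  proof -
    have "A \<in> sets M" if "A \<in> pp_filtration M N s" "s \<le> S" for A s
      using that pp_filtration_subset_sets[of s] S by auto
    then have "pred_rectangles S \<subseteq> sets ?R"
      using rect sets.sets_into_space by (fastforce simp: sets_restrict_space_iff)
    moreover have "space ?R = {0..S} \<times> space M"
      by (auto simp: space_restrict_space space_pair_measure)
    ultimately show ?thesis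
      unfolding sets_predictable using sets.sigma_sets_subset[of "pred_rectangles S" ?R] by simp
  qed
  then have "subalgebra ?R (predictable_algebra M N S)"
    by (auto simp: subalgebra_def space_restrict_space space_pair_measure)
  from measurable_from_subalg[OF this predictable]
  have "(\<lambda>p. indicator ({0..S} \<times> space M) p *\<^sub>R (case p of (t, \<omega>) \<Rightarrow> \<nu> t \<omega>)) \<in> borel_measurable (borel \<Otimes>\<^sub>M M)"
    using rect by (subst (asm) borel_measurable_restrict_space_iff) (auto simp: split_beta)
  then show ?thesis
    by (rule measurable_cong[THEN iffD1, rotated]) (auto simp: space_pair_measure indicator_def)
qed

end

section \<open>The Ito inequality\<close>

lemma set_integrable_bounded_Icc:
  fixes g :: "real \<Rightarrow> real"
  assumes "(\<lambda>u. indicator {a..b} u * g u) \<in> borel_measurable borel" "\<And>u. u \<in> {a..b} \<Longrightarrow> \<bar>g u\<bar> \<le> K"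
  shows "set_integrable lborel {a..b} g"
  unfolding set_integrable_def
proof (rule Bochner_Integration.integrable_bound)
  show "integrable lborel (\<lambda>u. indicator {a..b} u * K)"
    by (intro integrable_mult_left integrable_real_indicator) (auto simp: emeasure_lborel_Icc_eq)
  show "AE u in lborel. norm (indicator {a..b} u *\<^sub>R g u) \<le> norm (indicator {a..b} u * K)"
    using assms(2) by (auto simp: indicator_def intro: order_trans[OF _ abs_ge_self])
qed (use assms(1) in simp)

context strip_intensity
begin

lemma measurable_section:
  fixes p :: "real \<Rightarrow> real"
  assumes "\<omega> \<in> space M" "0 \<le> s" "t \<le> S" "p \<in> borel_measurable borel"
  shows "(\<lambda>u. indicator {s..t} u * p (\<nu> u \<omega>)) \<in> borel_measurable borel"
proof -
  have "(\<lambda>u. indicator {0..S} u * \<nu> u \<omega>) \<in> borel_measurable borel"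
    using measurable_compose[OF measurable_Pair2'[OF assms(1), of borel] measurable_intensity] by simp
  note comp = measurable_compose[OF this assms(4)]
  have "(\<lambda>u. indicator {s..t} u * p (indicator {0..S} u * \<nu> u \<omega>)) \<in> borel_measurable borel"
    by (rule borel_measurable_times[OF borel_measurable_indicator comp]) simp
  moreover have "indicator {s..t} u * p (indicator {0..S} u * \<nu> u \<omega>) = indicator {s..t} u * p (\<nu> u \<omega>)" for u
    using assms(2,3) by (auto simp: indicator_def)
  ultimately show ?thesis
    by simp
qed

lemma bounded_section:
  fixes p :: "real \<Rightarrow> real"
  assumes "\<omega> \<in> space M" "0 \<le> s" "t \<le> S" and p: "p \<in> borel_measurable borel" "\<And>x. 0 \<le> x \<Longrightarrow> x \<le> C \<Longrightarrow> \<bar>p x\<bar> \<le> K"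
  shows "set_integrable lborel {s..t} (\<lambda>u. p (\<nu> u \<omega>))"
    and "s \<le> t \<Longrightarrow> \<bar>LINT u:{s..t}|lborel. p (\<nu> u \<omega>)\<bar> \<le> K * (t - s)"
proof -
  have b: "\<bar>p (\<nu> u \<omega>)\<bar> \<le> K" if "u \<in> {s..t}" for u
    using that assms(1-3) by (intro p(2) \<nu>_nonneg \<nu>_le) auto
  show i: "set_integrable lborel {s..t} (\<lambda>u. p (\<nu> u \<omega>))"
    by (rule set_integrable_bounded_Icc[OF measurable_section[OF assms(1-4)] b])
  have c: "set_integrable lborel {s..t} (\<lambda>u. c)" for c :: real
    by (rule set_integrable_bounded_Icc[of _ _ _ "\<bar>c\<bar>"]) auto
  have "(LINT u:{s..t}|lborel. p (\<nu> u \<omega>)) \<le> (LINT u:{s..t}|lborel. K)"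
    by (intro set_integral_mono i c abs_le_D1[OF b])
  moreover have "(LINT u:{s..t}|lborel. - K) \<le> (LINT u:{s..t}|lborel. p (\<nu> u \<omega>))"
    using b by (intro set_integral_mono i c) (smt (verit, best))
  ultimately show "\<bar>LINT u:{s..t}|lborel. p (\<nu> u \<omega>)\<bar> \<le> K * (t - s)" if "s \<le> t"
    using that by (simp add: set_integral_const abs_le_iff mult.commute)
qed

lemma integrable_time_integral:
  fixes p :: "real \<Rightarrow> real"
  assumes "0 \<le> s" "s \<le> t" "t \<le> S" and p: "p \<in> borel_measurable borel" "\<And>x. 0 \<le> x \<Longrightarrow> x \<le> C \<Longrightarrow> \<bar>p x\<bar> \<le> K"
  shows "integrable M (\<lambda>\<omega>. LINT u:{s..t}|lborel. p (\<nu> u \<omega>))"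
proof (rule integrable_const_bound[of _ "K * (t - s)"])
  show "AE \<omega> in M. norm (LINT u:{s..t}|lborel. p (\<nu> u \<omega>)) \<le> K * (t - s)"
    using bounded_section(2)[OF _ assms(1,3) p assms(2)] by auto
  note [measurable] = p(1)
  have "(\<lambda>(\<omega>, u). indicator {0..S} u * \<nu> u \<omega>) \<in> borel_measurable (M \<Otimes>\<^sub>M lborel)"
    using measurable_pair_swap[OF measurable_intensity] by (simp add: split_beta)
  from measurable_compose[OF this p(1)]
  have [measurable]: "(\<lambda>x. p (indicator {0..S} (snd x) * \<nu> (snd x) (fst x))) \<in> borel_measurable (M \<Otimes>\<^sub>M lborel)"
    by (simp add: split_beta)
  have "(\<lambda>\<omega>. \<integral>u. indicator {s..t} u * p (indicator {0..S} u * \<nu> u \<omega>) \<partial>lborel) \<in> borel_measurable M"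
    by (intro lborel.borel_measurable_lebesgue_integral) (simp add: split_beta)
  moreover have "(\<lambda>u. indicator {s..t} u * p (indicator {0..S} u * \<nu> u \<omega>)) = (\<lambda>u. indicator {s..t} u * p (\<nu> u \<omega>))" for \<omega>
    using assms(1,3) by (auto simp: indicator_def fun_eq_iff)
  ultimately show "(\<lambda>\<omega>. LINT u:{s..t}|lborel. p (\<nu> u \<omega>)) \<in> borel_measurable M"
    by (simp add: set_lebesgue_integral_def)
qed

lemma nn_integral_intensity:
  assumes "\<omega> \<in> space M" "0 \<le> s" "s \<le> t" "t \<le> S"
  shows "(\<integral>\<^sup>+u. indicator {s<..<t} u * ennreal (\<nu> u \<omega>) \<partial>lborel) = ennreal (LINT u:{s..t}|lborel. \<nu> u \<omega>)"
proof -
  have i: "set_integrable lborel {s..t} (\<lambda>u. \<nu> u \<omega>)"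
    using bounded_section(1)[OF assms(1,2,4), of "\<lambda>x. x" C] by auto
  have "AE u in lborel. u \<noteq> s \<and> u \<noteq> t"
    using AE_lborel_singleton[of s] AE_lborel_singleton[of t] by eventually_elim auto
  then have "AE u in lborel. indicator {s<..<t} u * ennreal (\<nu> u \<omega>) = ennreal (indicator {s..t} u *\<^sub>R \<nu> u \<omega>)"
    by eventually_elim (auto simp: indicator_def)
  then have "(\<integral>\<^sup>+u. indicator {s<..<t} u * ennreal (\<nu> u \<omega>) \<partial>lborel) =
      (\<integral>\<^sup>+u. ennreal (indicator {s..t} u *\<^sub>R \<nu> u \<omega>) \<partial>lborel)"
    by (rule nn_integral_cong_AE)
  also have "\<dots> = ennreal (LINT u:{s..t}|lborel. \<nu> u \<omega>)"
    unfolding set_lebesgue_integral_def using i[unfolded set_integrable_def]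
    by (rule nn_integral_eq_integral) (use \<nu>_nonneg[OF _ assms(1)] assms in \<open>auto simp: indicator_def\<close>)
  finally show ?thesis .
qed

lemma increment_points:
  assumes "0 \<le> s" "s \<le> t" "t \<le> S"
  defines "R \<equiv> {s..t} \<times> {0..C}"
  shows "integrable M (\<lambda>\<omega>. real (points R \<omega>))"
    and "expectation (\<lambda>\<omega>. real (points R \<omega>)) = C * (t - s)"
    and "integrable M (\<lambda>\<omega>. real (points R \<omega>) * (real (points R \<omega>) - 1))"
    and "expectation (\<lambda>\<omega>. real (points R \<omega>) * (real (points R \<omega>) - 1)) = (C * (t - s))\<^sup>2"
proof -
  have R: "R \<in> sets borel" "R \<subseteq> strip T" "bounded R"
    using assms S by (auto simp: R_def strip_def intro!: borel_Times bounded_Times)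
  have "measure lborel R = C * (t - s)"
    unfolding R_def lborel_prod[symmetric]
    using C_nonneg assms by (simp add: measure_def lborel.emeasure_pair_measure_Times enn2real_mult)
  with points_moments[OF R]
  show "integrable M (\<lambda>\<omega>. real (points R \<omega>))"
    and "expectation (\<lambda>\<omega>. real (points R \<omega>)) = C * (t - s)"
    and "integrable M (\<lambda>\<omega>. real (points R \<omega>) * (real (points R \<omega>) - 1))"
    and "expectation (\<lambda>\<omega>. real (points R \<omega>) * (real (points R \<omega>) - 1)) = (C * (t - s))\<^sup>2"
    by auto
qed

text \<open>Used as densities on M, the increment and its compensator give \<open>X s\<close> the
  same weighted law: on each event X s = k, which belongs to the past of s, this is
  \<open>nn_integral_increment\<close>. Integrating h against the common law gives the
  claim.\<close>

lemma expectation_past_times_increment: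
  assumes s: "0 \<le> s" "s \<le> t" "t \<le> S"
  shows "expectation (\<lambda>\<omega>. real (X t \<omega> - X s \<omega>) * h (X s \<omega>)) =
    expectation (\<lambda>\<omega>. (LINT u:{s..t}|lborel. \<nu> u \<omega>) * h (X s \<omega>))"
proof -
  have [measurable]: "X s \<in> measurable M (count_space UNIV)" "X t \<in> measurable M (count_space UNIV)"
    using s by (auto intro!: counting_process_measurable)
  let ?I = "\<lambda>\<omega>. LINT u:{s..t}|lborel. \<nu> u \<omega>"
  have [measurable]: "?I \<in> borel_measurable M"
    using integrable_time_integral[OF s, of "\<lambda>x. x" C] by auto
  have I: "0 \<le> ?I \<omega>" if "\<omega> \<in> space M" for \<omega>
    unfolding set_lebesgue_integral_def
    by (rule integral_nonneg_AE) (use \<nu>_nonneg[OF _ that] s in \<open>auto simp: indicator_def\<close>)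
  have "distr (density M (\<lambda>\<omega>. ennreal (real (X t \<omega> - X s \<omega>)))) (count_space UNIV) (X s) =
      distr (density M (\<lambda>\<omega>. ennreal (?I \<omega>))) (count_space UNIV) (X s)"
  proof (rule measure_eqI_countable)
    fix k :: nat
    let ?A = "X s -` {k} \<inter> space M"
    have "?A \<in> pp_filtration M N s"
      using measurable_sets[OF counting_process_adapted[of s], of "{k}"] s by simp
    from nn_integral_increment[OF this s]
    have "(\<integral>\<^sup>+\<omega>. indicator ?A \<omega> * of_nat (X t \<omega> - X s \<omega>) \<partial>M) = (\<integral>\<^sup>+\<omega>. indicator ?A \<omega> * ennreal (?I \<omega>) \<partial>M)"
      using s by (simp add: nn_integral_intensity cong: nn_integral_cong)
    then show "emeasure (distr (density M (\<lambda>\<omega>. ennreal (real (X t \<omega> - X s \<omega>)))) (count_space UNIV) (X s)) {k} =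
        emeasure (distr (density M (\<lambda>\<omega>. ennreal (?I \<omega>))) (count_space UNIV) (X s)) {k}"
      by (simp add: emeasure_distr emeasure_density ennreal_of_nat_eq_real_of_nat mult.commute)
  qed auto
  from arg_cong[OF this, of "\<lambda>K. integral\<^sup>L K h"] show ?thesis
    using I by (simp add: integral_distr integral_density AE_I2)
qed

lemma integrable_bounded_function:
  assumes "t \<in> {0..S}" "\<And>k. \<bar>h k\<bar> \<le> (K :: real)"
  shows "integrable M (\<lambda>\<omega>. h (X t \<omega>))"
proof -
  have [measurable]: "X t \<in> measurable M (count_space UNIV)"
    using assms by (intro counting_process_measurable)
  show ?thesis
    by (rule integrable_const_bound[of _ K]) (use assms in auto)
qed

lemma integrable_times_increment:
  assumes s: "0 \<le> s" "s \<le> t" "t \<le> S" and h: "\<And>k. \<bar>h k\<bar> \<le> (K :: real)"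
  shows "integrable M (\<lambda>\<omega>. real (X t \<omega> - X s \<omega>) * h (X s \<omega>))"
    and "integrable M (\<lambda>\<omega>. (LINT u:{s..t}|lborel. \<nu> u \<omega>) * h (X s \<omega>))"
proof -
  have [measurable]: "X s \<in> measurable M (count_space UNIV)" "X t \<in> measurable M (count_space UNIV)"
    using s by (auto intro!: counting_process_measurable)
  have K: "0 \<le> K"
    using h[of 0] by auto
  show "integrable M (\<lambda>\<omega>. real (X t \<omega> - X s \<omega>) * h (X s \<omega>))"
  proof (rule Bochner_Integration.integrable_bound)
    show "integrable M (\<lambda>\<omega>. real (points ({s..t} \<times> {0..C}) \<omega>) * K)"
      using increment_points(1)[OF s] by simp
    show "AE \<omega> in M. norm (real (X t \<omega> - X s \<omega>) * h (X s \<omega>)) \<le> norm (real (points ({s..t} \<times> {0..C}) \<omega>) * K)"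
    proof (rule AE_I2)
      fix \<omega> assume "\<omega> \<in> space M"
      then have "X t \<omega> - X s \<omega> \<le> points ({s..t} \<times> {0..C}) \<omega>"
        using increment_bounds[OF _ s] by (simp add: le_diff_conv add.commute)
      then show "norm (real (X t \<omega> - X s \<omega>) * h (X s \<omega>)) \<le> norm (real (points ({s..t} \<times> {0..C}) \<omega>) * K)"
        using h K by (auto simp: abs_mult intro!: mult_mono)
    qed
  qed simp
  have I[measurable]: "integrable M (\<lambda>\<omega>. LINT u:{s..t}|lborel. \<nu> u \<omega>)"
    using integrable_time_integral[OF s, of "\<lambda>x. x" C] by auto
  show "integrable M (\<lambda>\<omega>. (LINT u:{s..t}|lborel. \<nu> u \<omega>) * h (X s \<omega>))"
  proof (rule Bochner_Integration.integrable_bound)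
    show "integrable M (\<lambda>\<omega>. (LINT u:{s..t}|lborel. \<nu> u \<omega>) * K)"
      using I by simp
    show "AE \<omega> in M. norm ((LINT u:{s..t}|lborel. \<nu> u \<omega>) * h (X s \<omega>)) \<le> norm ((LINT u:{s..t}|lborel. \<nu> u \<omega>) * K)"
      using h K by (auto simp: abs_mult intro!: mult_left_mono)
  qed (use borel_measurable_integrable[OF I] in measurable)
qed

text \<open>Write \<open>F t (X t) - F s (X s)\<close> as the drift \<open>F t (X s) - F s (X s)\<close>, plus the linearised jump
  \<open>(X t - X s) * (F t (X s + 1) - F t (X s))\<close>, plus a remainder that vanishes unless there are two
  or more jumps, and is therefore controlled by the second factorial moment of the number of
  points in the rectangle.\<close>

lemma ito_inequality_step:
  fixes F F' :: "real \<Rightarrow> nat \<Rightarrow> real" and p :: "real \<Rightarrow> real"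
  assumes deriv: "\<And>k u. u \<in> {0..S} \<Longrightarrow> ((\<lambda>u. F u k) has_real_derivative F' u k) (at u within {0..S})"
    and cont: "\<And>k. continuous_on {0..S} (\<lambda>u. F' u k)"
    and F: "\<And>k u. u \<in> {0..S} \<Longrightarrow> \<bar>F u k\<bar> \<le> K" and F': "\<And>k u. u \<in> {0..S} \<Longrightarrow> \<bar>F' u k\<bar> \<le> K"
    and p: "p \<in> borel_measurable borel" "\<And>x. 0 \<le> x \<Longrightarrow> x \<le> C \<Longrightarrow> \<bar>p x\<bar> \<le> K"
    and ineq: "AE \<omega> in M. \<forall>s u t. 0 \<le> s \<and> s \<le> u \<and> u \<le> t \<and> t \<le> S \<longrightarrow>
      F' u (X s \<omega>) + \<nu> u \<omega> * (F u (Suc (X s \<omega>)) - F u (X s \<omega>)) \<le> p (\<nu> u \<omega>) + K * real (X t \<omega> - X s \<omega>)"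
    and s: "0 \<le> s" "s \<le> t" "t \<le> S"
  shows "expectation (\<lambda>\<omega>. F t (X t \<omega>)) - expectation (\<lambda>\<omega>. F s (X s \<omega>)) \<le>
    expectation (\<lambda>\<omega>. LINT u:{s..t}|lborel. p (\<nu> u \<omega>)) + (4 * K * C\<^sup>2 + 3 * K * C) * (t - s)\<^sup>2"
proof -
  define D where "D u k = F u (Suc k) - F u k" for u k
  define Y where "Y \<omega> = real (X t \<omega> - X s \<omega>)" for \<omega>
  define m where "m \<omega> = real (points ({s..t} \<times> {0..C}) \<omega>)" for \<omega>
  define I where "I \<omega> = (LINT u:{s..t}|lborel. \<nu> u \<omega>)" for \<omega>
  define J where "J \<omega> = (LINT u:{s..t}|lborel. p (\<nu> u \<omega>))" for \<omega>
  have st: "s \<in> {0..S}" "t \<in> {0..S}"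
    using s by auto
  have K: "0 \<le> K"
    using F[OF st(1), of 0] by auto
  have D: "\<bar>D u k\<bar> \<le> 2 * K" if "u \<in> {0..S}" for u k
    using F[OF that, of k] F[OF that, of "Suc k"] by (auto simp: D_def)
  have lip: "\<bar>F t k - F u k\<bar> \<le> K * (t - u)" if "u \<in> {s..t}" for u k
    using field_differentiable_bound[OF convex_closed_interval[of 0 S] deriv[of _ k], of K t u] F' that s by auto
  have Dlip: "D t k \<le> D u k + 2 * K * (t - s)" if "u \<in> {s..t}" for u k
  proof -
    have "K * (t - u) \<le> K * (t - s)"
      using that K by (intro mult_left_mono) auto
    then show ?thesis
      using lip[OF that, of k] lip[OF that, of "Suc k"] by (auto simp: D_def abs_le_iff)
  qed
  have sub: "{s..t} \<subseteq> {0..S}"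
    using s by auto
  have FTC: "set_integrable lborel {s..t} (\<lambda>u. F' u k)" "(LINT u:{s..t}|lborel. F' u k) = F t k - F s k" for k
  proof -
    have c: "continuous_on {s..t} (\<lambda>u. F' u k)"
      by (rule continuous_on_subset[OF cont sub])
    show "set_integrable lborel {s..t} (\<lambda>u. F' u k)"
      by (rule borel_integrable_atLeastAtMost'[OF c])
    show "(LINT u:{s..t}|lborel. F' u k) = F t k - F s k"
      unfolding set_lebesgue_integral_def
    proof (rule integral_FTC_Icc[OF s(2) _ c])
      show "((\<lambda>u. F u k) has_vector_derivative F' u k) (at u within {s..t})" if "s \<le> u" "u \<le> t" for u
        using DERIV_subset[OF deriv[of u k] sub] that s
        by (simp add: has_real_derivative_iff_has_vector_derivative)
    qed
  qed
  \<comment> \<open>The remainder vanishes for d = 0 and d = 1 jumps. For d >= 2, the bounds K on F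
    and 2K on D give at most K(2 + 2d), and 2 + 2d <= 4d <= 4d(d-1). This is the origin of
    4K.\<close>
  have jump: "F t (X t \<omega>) \<le> F t (X s \<omega>) + Y \<omega> * D t (X s \<omega>) + 4 * K * (m \<omega> * (m \<omega> - 1))"
    and Ym: "Y \<omega> \<le> m \<omega>" if "\<omega> \<in> space M" for \<omega>
  proof -
    define d where "d = X t \<omega> - X s \<omega>"
    note inc = increment_bounds[OF that s]
    have Xt: "X t \<omega> = X s \<omega> + d"
      using inc by (simp add: d_def)
    have dm: "d \<le> points ({s..t} \<times> {0..C}) \<omega>"
      using inc by (simp add: d_def le_diff_conv add.commute)
    then show "Y \<omega> \<le> m \<omega>"
      by (simp add: Y_def m_def d_def)
    have m: "0 \<le> m \<omega> * (m \<omega> - 1)"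
      by (cases "points ({s..t} \<times> {0..C}) \<omega>") (auto simp: m_def)
    consider "d = 0" | "d = 1" | "2 \<le> d"
      by linarith
    then show "F t (X t \<omega>) \<le> F t (X s \<omega>) + Y \<omega> * D t (X s \<omega>) + 4 * K * (m \<omega> * (m \<omega> - 1))"
    proof cases
      case 1
      then show ?thesis
        using m K by (simp add: Xt Y_def)
    next
      case 2
      then show ?thesis
        using m K by (simp add: Xt Y_def D_def)
    next
      case 3
      let ?d = "real d"
      have d2: "2 \<le> ?d"
        using 3 by simp
      have "F t (X t \<omega>) - F t (X s \<omega>) - ?d * D t (X s \<omega>) \<le> K + K + ?d * (2 * K)"
      proof -
        have "- (?d * D t (X s \<omega>)) \<le> ?d * (2 * K)"
          using mult_left_mono[of "- D t (X s \<omega>)" "2 * K" ?d] D[OF st(2), of "X s \<omega>"] by auto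
        then show ?thesis
          using F[OF st(2), of "X t \<omega>"] F[OF st(2), of "X s \<omega>"] by auto
      qed
      also have "\<dots> = K * (2 + 2 * ?d)"
        by (simp add: algebra_simps)
      also have "\<dots> \<le> K * (4 * (?d * (?d - 1)))"
      proof (rule mult_left_mono[OF _ K])
        have "2 + 2 * ?d \<le> 4 * ?d"
          using d2 by simp
        also have "\<dots> \<le> 4 * (?d * (?d - 1))"
          using mult_left_mono[of 1 "?d - 1" ?d] d2 by simp
        finally show "2 + 2 * ?d \<le> 4 * (?d * (?d - 1))" .
      qed
      also have "\<dots> \<le> K * (4 * (m \<omega> * (m \<omega> - 1)))"
        using dm d2 by (intro mult_left_mono K mult_mono) (auto simp: m_def)
      finally show ?thesis
        by (simp add: Y_def d_def)
    qed
  qed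
  \<comment> \<open>Replacing D at time u by D at time t costs at most 2KC(t-s) in the integrand,
    and the slack in \<open>ineq\<close> is at most K times \<open>m\<close>. After integration over
    the step and expectation, with \<open>m\<close> of mean C(t-s), these two errors add up to the
    term with 3KC.\<close>
  have drift: "AE \<omega> in M. I \<omega> * D t (X s \<omega>) + (F t (X s \<omega>) - F s (X s \<omega>)) \<le>
      J \<omega> + 2 * K * C * (t - s)\<^sup>2 + K * (t - s) * m \<omega>"
    using ineq AE_space
  proof eventually_elim
    case (elim \<omega>)
    let ?k = "X s \<omega>"
    have i\<nu>: "set_integrable lborel {s..t} (\<lambda>u. \<nu> u \<omega>)"
      using bounded_section(1)[OF elim(2) s(1,3), of "\<lambda>x. x" C] by auto
    have ip: "set_integrable lborel {s..t} (\<lambda>u. p (\<nu> u \<omega>))"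
      by (rule bounded_section(1)[OF elim(2) s(1,3) p])
    have c: "set_integrable lborel {s..t} (\<lambda>u. c)" for c :: real
      by (rule set_integrable_bounded_Icc[of _ _ _ "\<bar>c\<bar>"]) auto
    have "I \<omega> * D t ?k + (F t ?k - F s ?k) = (LINT u:{s..t}|lborel. D t ?k * \<nu> u \<omega> + F' u ?k)"
      using i\<nu> FTC[of ?k] by (subst set_integral_add) (auto simp: I_def set_integrable_mult_right mult.commute)
    also have "\<dots> \<le> (LINT u:{s..t}|lborel. p (\<nu> u \<omega>) + (2 * K * C * (t - s) + K * m \<omega>))"
    proof (rule set_integral_mono)
      show "set_integrable lborel {s..t} (\<lambda>u. D t ?k * \<nu> u \<omega> + F' u ?k)"
        using i\<nu> FTC[of ?k] by auto
      show "set_integrable lborel {s..t} (\<lambda>u. p (\<nu> u \<omega>) + (2 * K * C * (t - s) + K * m \<omega>))"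
        using ip c by auto
      fix u assume u: "u \<in> {s..t}"
      have \<nu>: "0 \<le> \<nu> u \<omega>" "\<nu> u \<omega> \<le> C"
        using u s elim(2) by (auto intro!: \<nu>_nonneg \<nu>_le)
      have "D t ?k * \<nu> u \<omega> \<le> (D u ?k + 2 * K * (t - s)) * \<nu> u \<omega>"
        by (rule mult_right_mono[OF Dlip[OF u] \<nu>(1)])
      also have "\<dots> = \<nu> u \<omega> * D u ?k + 2 * K * (t - s) * \<nu> u \<omega>"
        by (simp add: algebra_simps)
      also have "\<dots> \<le> \<nu> u \<omega> * D u ?k + 2 * K * (t - s) * C"
        using K s by (intro add_left_mono mult_left_mono \<nu>(2)) auto
      finally have "D t ?k * \<nu> u \<omega> + F' u ?k \<le> F' u ?k + \<nu> u \<omega> * D u ?k + 2 * K * C * (t - s)"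
        by (simp add: algebra_simps)
      also have "F' u ?k + \<nu> u \<omega> * D u ?k \<le> p (\<nu> u \<omega>) + K * Y \<omega>"
        using elim(1)[rule_format, of s u t] u s by (simp add: D_def Y_def)
      also have "K * Y \<omega> \<le> K * m \<omega>"
        by (rule mult_left_mono[OF Ym[OF elim(2)] K])
      finally show "D t ?k * \<nu> u \<omega> + F' u ?k \<le> p (\<nu> u \<omega>) + (2 * K * C * (t - s) + K * m \<omega>)"
        by simp
    qed
    also have "\<dots> = J \<omega> + (LINT u:{s..t}|lborel. 2 * K * C * (t - s) + K * m \<omega>)"
      using ip c by (subst set_integral_add) (auto simp: J_def)
    also have "(LINT u:{s..t}|lborel. 2 * K * C * (t - s) + K * m \<omega>) = (t - s) * (2 * K * C * (t - s) + K * m \<omega>)"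
      using s by (subst set_integral_const) auto
    finally show ?case
      by (simp add: algebra_simps power2_eq_square)
  qed
  note int_m = increment_points[OF s, folded m_def]
  have int_J: "integrable M J"
    unfolding J_def by (rule integrable_time_integral[OF s p])
  note int_D = integrable_times_increment[OF s, where h="D t", OF D[OF st(2)], folded Y_def I_def]
  have int_F: "integrable M (\<lambda>\<omega>. F t (X t \<omega>))" "integrable M (\<lambda>\<omega>. F t (X s \<omega>))" "integrable M (\<lambda>\<omega>. F s (X s \<omega>))"
    using integrable_bounded_function st F by blast+
  have "expectation (\<lambda>\<omega>. F t (X t \<omega>)) \<le>
      expectation (\<lambda>\<omega>. F t (X s \<omega>) + Y \<omega> * D t (X s \<omega>) + 4 * K * (m \<omega> * (m \<omega> - 1)))"
    by (intro integral_mono int_F Bochner_Integration.integrable_add integrable_mult_right int_m int_D) (rule jump)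
  also have "\<dots> = expectation (\<lambda>\<omega>. F t (X s \<omega>)) + expectation (\<lambda>\<omega>. Y \<omega> * D t (X s \<omega>)) + 4 * K * (C * (t - s))\<^sup>2"
    by (simp add: int_F int_D int_m)
  \<comment> \<open>The factor D is evaluated at the deterministic time t and at the state at time
    s, hence is determined by the past of s; so the compensator may replace the increment.\<close>
  also have "expectation (\<lambda>\<omega>. Y \<omega> * D t (X s \<omega>)) = expectation (\<lambda>\<omega>. I \<omega> * D t (X s \<omega>))"
    unfolding Y_def I_def by (rule expectation_past_times_increment[OF s])
  finally have 1: "expectation (\<lambda>\<omega>. F t (X t \<omega>)) \<le> expectation (\<lambda>\<omega>. F t (X s \<omega>)) +
      expectation (\<lambda>\<omega>. I \<omega> * D t (X s \<omega>)) + 4 * K * (C * (t - s))\<^sup>2" .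
  have "expectation (\<lambda>\<omega>. I \<omega> * D t (X s \<omega>) + (F t (X s \<omega>) - F s (X s \<omega>))) \<le>
      expectation (\<lambda>\<omega>. J \<omega> + 2 * K * C * (t - s)\<^sup>2 + K * (t - s) * m \<omega>)"
    by (intro integral_mono_AE drift int_D int_F int_J Bochner_Integration.integrable_add
        Bochner_Integration.integrable_diff integrable_mult_right int_m integrable_const)
  then have 2: "expectation (\<lambda>\<omega>. I \<omega> * D t (X s \<omega>)) + expectation (\<lambda>\<omega>. F t (X s \<omega>)) - expectation (\<lambda>\<omega>. F s (X s \<omega>)) \<le>
      expectation J + 2 * K * C * (t - s)\<^sup>2 + K * (t - s) * (C * (t - s))"
    by (simp add: int_F int_D int_m int_J prob_space)
  from 1 2 show ?thesis
    unfolding J_def[symmetric] by (simp add: algebra_simps power2_eq_square)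
qed

text \<open>A slack proportional to the number of jumps is affordable: integrated over a step of
  length d, its expectation is of order d^2. With n equal steps each error is c / n^2, and the
  telescoped total c / n tends to 0.\<close>

lemma ito_inequality:
  fixes F F' :: "real \<Rightarrow> nat \<Rightarrow> real" and p :: "real \<Rightarrow> real"
  assumes deriv: "\<And>k u. u \<in> {0..S} \<Longrightarrow> ((\<lambda>u. F u k) has_real_derivative F' u k) (at u within {0..S})"
    and cont: "\<And>k. continuous_on {0..S} (\<lambda>u. F' u k)"
    and F: "\<And>k u. u \<in> {0..S} \<Longrightarrow> \<bar>F u k\<bar> \<le> K" and F': "\<And>k u. u \<in> {0..S} \<Longrightarrow> \<bar>F' u k\<bar> \<le> K"
    and p: "p \<in> borel_measurable borel" "\<And>x. 0 \<le> x \<Longrightarrow> x \<le> C \<Longrightarrow> \<bar>p x\<bar> \<le> K"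
    and ineq: "AE \<omega> in M. \<forall>s u t. 0 \<le> s \<and> s \<le> u \<and> u \<le> t \<and> t \<le> S \<longrightarrow>
      F' u (X s \<omega>) + \<nu> u \<omega> * (F u (Suc (X s \<omega>)) - F u (X s \<omega>)) \<le> p (\<nu> u \<omega>) + K * real (X t \<omega> - X s \<omega>)"
  shows "expectation (\<lambda>\<omega>. F S (X S \<omega>)) - F 0 0 \<le> expectation (\<lambda>\<omega>. LINT u:{0..S}|lborel. p (\<nu> u \<omega>))"
proof -
  define c where "c = (4 * K * C\<^sup>2 + 3 * K * C) * S\<^sup>2"
  define J where "J t = expectation (\<lambda>\<omega>. LINT u:{0..t}|lborel. p (\<nu> u \<omega>))" for t
  have bound: "expectation (\<lambda>\<omega>. F S (X S \<omega>)) - F 0 0 \<le> J S + c / real n" if n: "n > 0" for n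
  proof -
    define t where "t i = S * (real i / real n)" for i
    have t: "0 \<le> t i" "t i \<le> t (Suc i)" "i \<le> n \<Longrightarrow> t i \<le> S" for i
    proof -
      show "0 \<le> t i"
        using S by (simp add: t_def)
      show "t i \<le> t (Suc i)"
        unfolding t_def using S by (intro mult_left_mono divide_right_mono) auto
      show "t i \<le> S" if "i \<le> n"
        unfolding t_def using S that n by (intro mult_left_le) auto
    qed
    have step: "t (Suc i) - t i = S / n" for i
      using n by (simp add: t_def field_simps)
    have "expectation (\<lambda>\<omega>. F (t i) (X (t i) \<omega>)) - F 0 0 \<le> J (t i) + real i * (c / (real n)\<^sup>2)" if "i \<le> n" for i
      using that
    proof (induction i)
      case 0
      have "t 0 = 0"
        by (simp add: t_def)
      moreover have "(LINT u:{0..0}|lborel. p (\<nu> u \<omega>)) = 0" for \<omega>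
        using set_integral_const[of "{0..0::real}" lborel "p (\<nu> 0 \<omega>)"]
        by (subst set_lebesgue_integral_cong[where g="\<lambda>_. p (\<nu> 0 \<omega>)"]) auto
      ultimately show ?case
        by (simp add: counting_process_0 J_def prob_space)
    next
      case (Suc i)
      have ti: "t i \<le> S" "t (Suc i) \<le> S"
        using t(3)[of i] t(3)[of "Suc i"] Suc.prems by auto
      have split: "(LINT u:{0..t (Suc i)}|lborel. p (\<nu> u \<omega>)) =
          (LINT u:{0..t i}|lborel. p (\<nu> u \<omega>)) + (LINT u:{t i..t (Suc i)}|lborel. p (\<nu> u \<omega>))" if "\<omega> \<in> space M" for \<omega>
      proof -
        have "{0..t (Suc i)} = {0..t i} \<union> {t i..t (Suc i)}"
          using t(1,2)[of i] by auto
        moreover have "AE u in lborel. \<not> (u \<in> {0..t i} \<and> u \<in> {t i..t (Suc i)})"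
          using AE_lborel_singleton[of "t i"] by eventually_elim auto
        ultimately show ?thesis
          using bounded_section(1)[OF that _ _ p] t(1)[of i] ti by (simp add: set_integral_Un_AE)
      qed
      have "J (t (Suc i)) = J (t i) + expectation (\<lambda>\<omega>. LINT u:{t i..t (Suc i)}|lborel. p (\<nu> u \<omega>))"
        unfolding J_def using t ti p
        by (subst Bochner_Integration.integral_add[symmetric])
           (auto intro!: integrable_time_integral[where K=K] Bochner_Integration.integral_cong simp: split)
      moreover have "(4 * K * C\<^sup>2 + 3 * K * C) * (t (Suc i) - t i)\<^sup>2 = c / (real n)\<^sup>2"
        unfolding step c_def by (simp add: power_divide)
      ultimately have "expectation (\<lambda>\<omega>. F (t (Suc i)) (X (t (Suc i)) \<omega>)) - expectation (\<lambda>\<omega>. F (t i) (X (t i) \<omega>)) \<le>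
          J (t (Suc i)) - J (t i) + c / (real n)\<^sup>2"
        using ito_inequality_step[OF deriv cont F F' p ineq t(1,2) ti(2)] by simp
      then show ?case
        using Suc.IH Suc.prems by (simp add: algebra_simps add_divide_distrib)
    qed
    from this[of n] n show ?thesis
      by (simp add: t_def power2_eq_square)
  qed
  have "(\<lambda>n. J S + c / real n) \<longlonglongrightarrow> J S + 0"
    by (intro tendsto_add tendsto_const lim_const_over_n)
  moreover have "eventually (\<lambda>n. expectation (\<lambda>\<omega>. F S (X S \<omega>)) - F 0 0 \<le> J S + c / real n) sequentially"
    using eventually_gt_at_top[of 0] by eventually_elim (rule bound)
  ultimately have "expectation (\<lambda>\<omega>. F S (X S \<omega>)) - F 0 0 \<le> J S + 0"
    by (intro tendsto_lowerbound) auto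
  then show ?thesis
    by (simp add: J_def)
qed

end

section \<open>The Poisson-Foellmer process\<close>

lemma (in prob_space) expectation_nat_valued:
  assumes Z[measurable]: "Z \<in> measurable M (count_space UNIV)" and h: "\<And>k :: nat. \<bar>h k\<bar> \<le> (K :: real)"
  shows "expectation (\<lambda>\<omega>. h (Z \<omega>)) = (\<Sum>k. prob {\<omega> \<in> space M. Z \<omega> = k} * h k)"
proof -
  let ?q = "\<lambda>k. prob {\<omega> \<in> space M. Z \<omega> = k}"
  have distr: "distr M (count_space UNIV) Z = density (count_space UNIV) (\<lambda>k. ennreal (?q k))"
  proof (rule measure_eqI_countable)
    fix k
    have "Z -` {k} \<inter> space M = {\<omega> \<in> space M. Z \<omega> = k}"
      by auto
    then show "emeasure (distr M (count_space UNIV) Z) {k} = emeasure (density (count_space UNIV) (\<lambda>k. ennreal (?q k))) {k}"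
      by (simp add: emeasure_distr emeasure_density emeasure_eq_measure nn_integral_count_space_indicator
          nn_integral_indicator_singleton)
  qed auto
  have "integrable M (\<lambda>\<omega>. h (Z \<omega>))"
    by (rule integrable_const_bound[of _ K]) (use h in auto)
  then have "integrable (distr M (count_space UNIV) Z) h"
    by (subst integrable_distr_eq) auto
  then have "integrable (count_space UNIV) (\<lambda>k. ?q k * h k)"
    unfolding distr by (subst (asm) integrable_density) auto
  moreover have "expectation (\<lambda>\<omega>. h (Z \<omega>)) = integral\<^sup>L (distr M (count_space UNIV) Z) h"
    by (subst integral_distr) auto
  moreover have "integral\<^sup>L (distr M (count_space UNIV) Z) h = (LINT k|count_space UNIV. ?q k * h k)"
    unfolding distr by (subst integral_density) auto
  ultimately show ?thesis
    by (simp add: integral_count_space_nat)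
qed

lemma phi_nonneg: "0 \<le> x \<Longrightarrow> 0 \<le> phi x"
  using ln_le_minus_one[of "1 / x"] by (cases "x = 0") (auto simp: phi_def ln_div field_simps)

text \<open>The upper bound comes from ln x <= x - 1, hence x ln x <= x^2; the lower bound is
  \<open>phi_nonneg\<close>.\<close>

lemma phi_bound:
  assumes "0 \<le> x" "x \<le> C"
  shows "\<bar>phi x\<bar> \<le> C\<^sup>2 + 1"
proof -
  have "x * ln x \<le> C\<^sup>2"
  proof (cases "x = 0")
    case False
    then have "x * ln x \<le> x * x"
      using assms ln_le_minus_one[of x] by (intro mult_left_mono) auto
    also have "\<dots> \<le> C\<^sup>2"
      unfolding power2_eq_square using assms by (intro mult_mono) auto
    finally show ?thesis .
  qed auto
  then show ?thesis
    using phi_nonneg[OF assms(1)] assms by (auto simp: phi_def)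
qed

lemma phi_measurable: "phi \<in> borel_measurable borel"
  unfolding phi_def[abs_def] by measurable

text \<open>The convex conjugate of \<^const>\<open>phi\<close> at \<open>ln r\<close> is \<open>r - 1\<close>.\<close>

lemma phi_Young:
  assumes "0 \<le> x" "0 < r"
  shows "x * ln r - r + 1 \<le> phi x"
proof (cases "x = 0")
  case False
  then have "x * ln (r / x) \<le> x * (r / x - 1)"
    using assms by (intro mult_left_mono ln_le_minus_one) auto
  then show ?thesis
    using assms False by (simp add: phi_def ln_div algebra_simps)
qed (use assms in \<open>auto simp: phi_def\<close>)

text \<open>In the hypothesis of the Ito inequality the state is frozen at time \<open>s\<close>. It fails to be the state
  at time \<open>u\<close> only if there is a jump before \<open>t\<close>, and then the slack \<open>K * (X t - X s)\<close> takes over.\<close>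

lemma (in strip_intensity) ito_formula_markov:
  fixes F F' r :: "real \<Rightarrow> nat \<Rightarrow> real" and p :: "real \<Rightarrow> real"
  assumes deriv: "\<And>k u. u \<in> {0..S} \<Longrightarrow> ((\<lambda>u. F u k) has_real_derivative F' u k) (at u within {0..S})"
    and cont: "\<And>k. continuous_on {0..S} (\<lambda>u. F' u k)"
    and F: "\<And>k u. u \<in> {0..S} \<Longrightarrow> \<bar>F u k\<bar> \<le> K" and F': "\<And>k u. u \<in> {0..S} \<Longrightarrow> \<bar>F' u k\<bar> \<le> K"
    and p: "p \<in> borel_measurable borel" "\<And>x. 0 \<le> x \<Longrightarrow> x \<le> C \<Longrightarrow> \<bar>p x\<bar> \<le> K"
    and generator: "\<And>k u. u \<in> {0..S} \<Longrightarrow> F' u k + r u k * (F u (Suc k) - F u k) = p (r u k)"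
    and \<nu>: "AE \<omega> in M. \<forall>u\<in>{0..S}. \<nu> u \<omega> = r u (X u \<omega>)"
  shows "expectation (\<lambda>\<omega>. F S (X S \<omega>)) - F 0 0 = expectation (\<lambda>\<omega>. LINT u:{0..S}|lborel. p (\<nu> u \<omega>))"
proof -
  \<comment> \<open>The generator term is at most K + C(2K) and p at most K in absolute value. Their
    sum is the slack that a single jump has to provide.\<close>
  define K' where "K' = 2 * K + C * (2 * K)"
  have K: "0 \<le> K"
    using F[of 0 0] S by auto
  have "0 \<le> C * K"
    by (rule mult_nonneg_nonneg[OF C_nonneg K])
  then have KK': "K \<le> K'"
    using K by (simp add: K'_def)
  \<comment> \<open>The sign e applies the inequality to F with p and to -F with -p; together they
    give the equality.\<close>
  have main: "expectation (\<lambda>\<omega>. e * F S (X S \<omega>)) - e * F 0 0 \<le> expectation (\<lambda>\<omega>. LINT u:{0..S}|lborel. e * p (\<nu> u \<omega>))"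
    if e: "e = 1 \<or> e = -1" for e :: real
  proof (rule ito_inequality)
    have abs_e: "\<bar>e * x\<bar> = \<bar>x\<bar>" for x
      using e by auto
    show "((\<lambda>u. e * F u k) has_real_derivative e * F' u k) (at u within {0..S})" if "u \<in> {0..S}" for u k
      by (rule DERIV_cmult[OF deriv[OF that]])
    show "continuous_on {0..S} (\<lambda>u. e * F' u k)" for k
      by (intro continuous_on_mult continuous_on_const cont)
    show "\<bar>e * F u k\<bar> \<le> K'" "\<bar>e * F' u k\<bar> \<le> K'" if "u \<in> {0..S}" for u k
      unfolding abs_e using F[OF that, of k] F'[OF that, of k] KK' by auto
    show "(\<lambda>x. e * p x) \<in> borel_measurable borel"
      using p(1) by simp
    show "\<bar>e * p x\<bar> \<le> K'" if "0 \<le> x" "x \<le> C" for x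
      unfolding abs_e using p(2)[OF that] KK' by simp
    show "AE \<omega> in M. \<forall>s u t. 0 \<le> s \<and> s \<le> u \<and> u \<le> t \<and> t \<le> S \<longrightarrow>
        e * F' u (X s \<omega>) + \<nu> u \<omega> * (e * F u (Suc (X s \<omega>)) - e * F u (X s \<omega>)) \<le>
        e * p (\<nu> u \<omega>) + K' * real (X t \<omega> - X s \<omega>)"
      using \<nu> AE_space
    proof eventually_elim
      case (elim \<omega>)
      show ?case
      proof (intro allI impI)
        fix s u t assume "0 \<le> s \<and> s \<le> u \<and> u \<le> t \<and> t \<le> S"
        then have s: "0 \<le> s" "s \<le> u" "u \<le> S" "0 \<le> u" "u \<le> t" "t \<le> S" and u: "u \<in> {0..S}"
          by auto
        let ?G = "F' u (X s \<omega>) + \<nu> u \<omega> * (F u (Suc (X s \<omega>)) - F u (X s \<omega>))"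
        have "e * ?G \<le> e * p (\<nu> u \<omega>) + K' * real (X t \<omega> - X s \<omega>)"
        proof (cases "X u \<omega> = X s \<omega>")
          case True
          then have "?G = p (\<nu> u \<omega>)"
            using elim(1) generator[OF u, of "X s \<omega>"] u by simp
          moreover have "0 \<le> K' * real (X t \<omega> - X s \<omega>)"
            using K KK' by simp
          ultimately show ?thesis
            by simp
        next
          case False
          then have "X s \<omega> < X t \<omega>"
            using increment_bounds(1)[OF elim(2) s(1,2,3)] increment_bounds(1)[OF elim(2) s(4,5,6)] by simp
          then have "K' * 1 \<le> K' * real (X t \<omega> - X s \<omega>)"
            using K KK' by (intro mult_left_mono) auto
          moreover have "\<bar>?G\<bar> \<le> K + C * (2 * K)"
          proof -
            have "\<bar>\<nu> u \<omega> * (F u (Suc (X s \<omega>)) - F u (X s \<omega>))\<bar> \<le> C * (2 * K)"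
              unfolding abs_mult using \<nu>_nonneg[OF u elim(2)] \<nu>_le[OF u elim(2)]
                F[OF u, of "Suc (X s \<omega>)"] F[OF u, of "X s \<omega>"] C_nonneg by (intro mult_mono) auto
            then show ?thesis
              using F'[OF u, of "X s \<omega>"] by linarith
          qed
          moreover have "\<bar>p (\<nu> u \<omega>)\<bar> \<le> K"
            by (intro p(2) \<nu>_nonneg \<nu>_le u elim(2))
          ultimately show ?thesis
            using e unfolding K'_def by (auto simp: abs_le_iff)
        qed
        then show "e * F' u (X s \<omega>) + \<nu> u \<omega> * (e * F u (Suc (X s \<omega>)) - e * F u (X s \<omega>)) \<le>
            e * p (\<nu> u \<omega>) + K' * real (X t \<omega> - X s \<omega>)"
          by (simp add: algebra_simps)
      qed
    qed
  qed
  from main[of 1] main[of "-1"] show ?thesis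
    by (simp add: set_lebesgue_integral_def)
qed

section \<open>Uniform bounds for the space-time density and its logarithm\<close>

locale bounded_density =
  fixes f :: "nat \<Rightarrow> real" and c C\<^sub>f T :: real
  assumes c: "0 < c" and f_ge: "\<And>k. c \<le> f k" and f_le: "\<And>k. f k \<le> C\<^sub>f"
begin

definition G :: "real \<Rightarrow> nat \<Rightarrow> real" where
  "G u k = poisson_semigroup (T - u) f k"

lemma f_abs: "\<bar>f k\<bar> \<le> C\<^sub>f"
  using c f_ge[of k] f_le[of k] by simp

lemma C\<^sub>f: "0 < C\<^sub>f"
  using c f_ge[of 0] f_le[of 0] by simp

lemma G_bounds:
  assumes "u \<le> T"
  shows "c \<le> G u k" "G u k \<le> C\<^sub>f" "0 < G u k"
proof -
  show "c \<le> G u k" "G u k \<le> C\<^sub>f"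
    unfolding G_def using assms f_ge f_le
    by (auto intro!: poisson_semigroup_ge[OF f_abs] poisson_semigroup_le[OF f_abs])
  then show "0 < G u k"
    using c by simp
qed

lemma G_deriv: "u \<in> {0..S} \<Longrightarrow> S \<le> T \<Longrightarrow>
    ((\<lambda>u. G u k) has_real_derivative G u k - G u (Suc k)) (at u within {0..S})"
  unfolding G_def by (rule has_derivative_poisson_semigroup_backward[OF f_abs])

lemma G_cont: "S \<le> T \<Longrightarrow> continuous_on {0..S} (\<lambda>u. G u k)"
  unfolding G_def by (rule continuous_on_poisson_semigroup_backward[OF f_abs])

text \<open>One constant for both ln G and its time derivative: ln G lies between ln c and ln
  \<open>C\<^sub>f\<close>, and since 1 <= \<open>C\<^sub>f / c\<close>, the derivative is at most 1
  + \<open>C\<^sub>f / c\<close> <= \<open>2 * C\<^sub>f / c\<close> in absolute value.\<close>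

definition log_bound :: real where
  "log_bound = \<bar>ln c\<bar> + \<bar>ln C\<^sub>f\<bar> + 2 * C\<^sub>f / c"

lemma ln_G_deriv:
  assumes "u \<in> {0..S}" "S \<le> T"
  shows "((\<lambda>u. ln (G u k)) has_real_derivative 1 - G u (Suc k) / G u k) (at u within {0..S})"
proof -
  have "0 < G u k"
    using assms by (intro G_bounds) auto
  then show ?thesis
    by (auto intro!: derivative_eq_intros G_deriv[OF assms] simp: field_simps)
qed

lemma ln_G_deriv_cont:
  assumes "S \<le> T"
  shows "continuous_on {0..S} (\<lambda>u. 1 - G u (Suc k) / G u k)"
proof -
  have "G u k \<noteq> 0" if "u \<in> {0..S}" for u
    using G_bounds(3)[of u k] that assms by auto
  then show ?thesis
    using assms by (intro continuous_intros G_cont) auto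
qed

lemma ratio_bound:
  assumes "u \<le> T" "\<bar>x\<bar> \<le> C\<^sub>f"
  shows "\<bar>x / G u k\<bar> \<le> C\<^sub>f / c"
  using G_bounds[OF assms(1), of k] c assms(2) C\<^sub>f by (auto simp: abs_divide intro!: frac_le)

lemma ln_G_bounds:
  assumes "u \<le> T"
  shows "\<bar>ln (G u k)\<bar> \<le> log_bound" "\<bar>1 - G u (Suc k) / G u k\<bar> \<le> log_bound"
proof -
  have "ln c \<le> ln (G u k)" "ln (G u k) \<le> ln C\<^sub>f"
    using G_bounds[OF assms, of k] c C\<^sub>f by auto
  moreover have "0 < C\<^sub>f / c"
    using c C\<^sub>f by simp
  ultimately show "\<bar>ln (G u k)\<bar> \<le> log_bound"
    unfolding log_bound_def by (simp only: times_divide_eq_right[symmetric])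
  have "\<bar>G u (Suc k) / G u k\<bar> \<le> C\<^sub>f / c"
    using G_bounds[OF assms, of "Suc k"] by (intro ratio_bound assms) auto
  moreover have "1 \<le> C\<^sub>f / c"
    using c f_ge[of 0] f_le[of 0] by simp
  ultimately show "\<bar>1 - G u (Suc k) / G u k\<bar> \<le> log_bound"
    unfolding log_bound_def by (simp only: times_divide_eq_right[symmetric])
qed

end

section \<open>Cost inequality, equality case and terminal law\<close>

locale foellmer_setup = strip_intensity M N T S C \<nu> + bounded_density f c C\<^sub>f T
  for M :: "'a measure" and N T S C \<nu> f c C\<^sub>f
begin

lemma expectation_ln_G_le_cost:
  "expectation (\<lambda>\<omega>. ln (G S (X S \<omega>))) - ln (G 0 0) \<le> intensity_cost M S \<nu>"
  unfolding intensity_cost_def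
proof (rule ito_inequality[where F="\<lambda>u k. ln (G u k)" and F'="\<lambda>u k. 1 - G u (Suc k) / G u k"
      and K="log_bound + (C\<^sup>2 + 1)"])
  show "((\<lambda>u. ln (G u k)) has_real_derivative 1 - G u (Suc k) / G u k) (at u within {0..S})"
    if "u \<in> {0..S}" for k u
    by (rule ln_G_deriv[OF that S(2)])
  show "continuous_on {0..S} (\<lambda>u. 1 - G u (Suc k) / G u k)" for k
    by (rule ln_G_deriv_cont[OF S(2)])
  have C2: "0 \<le> C\<^sup>2 + 1"
    by simp
  show "\<bar>ln (G u k)\<bar> \<le> log_bound + (C\<^sup>2 + 1)" "\<bar>1 - G u (Suc k) / G u k\<bar> \<le> log_bound + (C\<^sup>2 + 1)" if "u \<in> {0..S}" for u k
  proof -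
    have "u \<le> T"
      using that S(2) by auto
    from ln_G_bounds[OF this, of k] C2
    show "\<bar>ln (G u k)\<bar> \<le> log_bound + (C\<^sup>2 + 1)" "\<bar>1 - G u (Suc k) / G u k\<bar> \<le> log_bound + (C\<^sup>2 + 1)"
      by linarith+
  qed
  have log_bound: "0 \<le> log_bound"
    using ln_G_bounds(1)[of 0 0] S by auto
  show "phi \<in> borel_measurable borel"
    by (rule phi_measurable)
  show "\<bar>phi x\<bar> \<le> log_bound + (C\<^sup>2 + 1)" if "0 \<le> x" "x \<le> C" for x
    using phi_bound[OF that] log_bound by simp
  show "AE \<omega> in M. \<forall>s u t. 0 \<le> s \<and> s \<le> u \<and> u \<le> t \<and> t \<le> S \<longrightarrow>
      1 - G u (Suc (X s \<omega>)) / G u (X s \<omega>) + \<nu> u \<omega> * (ln (G u (Suc (X s \<omega>))) - ln (G u (X s \<omega>)))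
        \<le> phi (\<nu> u \<omega>) + (log_bound + (C\<^sup>2 + 1)) * real (X t \<omega> - X s \<omega>)"
  proof (intro AE_I2 allI impI)
    fix \<omega> s u t assume \<omega>: "\<omega> \<in> space M" and s: "0 \<le> s \<and> s \<le> u \<and> u \<le> t \<and> t \<le> S"
    let ?k = "X s \<omega>"
    have G: "0 < G u ?k" "0 < G u (Suc ?k)"
      using s S by (auto intro!: G_bounds)
    have "\<nu> u \<omega> * ln (G u (Suc ?k) / G u ?k) - G u (Suc ?k) / G u ?k + 1 \<le> phi (\<nu> u \<omega>)"
      using \<nu>_nonneg[of u \<omega>] \<omega> s G by (intro phi_Young) auto
    moreover have "0 \<le> (log_bound + (C\<^sup>2 + 1)) * real (X t \<omega> - X s \<omega>)"
      using log_bound C2 by simp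
    ultimately show "1 - G u (Suc ?k) / G u ?k + \<nu> u \<omega> * (ln (G u (Suc ?k)) - ln (G u ?k))
        \<le> phi (\<nu> u \<omega>) + (log_bound + (C\<^sup>2 + 1)) * real (X t \<omega> - ?k)"
      using G by (simp add: ln_div)
  qed
qed

context
  assumes foellmer: "AE \<omega> in M. \<forall>u\<in>{0..S}. \<nu> u \<omega> = G u (Suc (X u \<omega>)) / G u (X u \<omega>)"
begin

text \<open>For \<nu> = r Young's inequality is an equality: 1 - r + r ln r = \<phi>(r). So the
  generator condition of \<open>ito_formula_markov\<close> holds with p = \<phi>.\<close>

lemma expectation_ln_G_eq_cost:
  "expectation (\<lambda>\<omega>. ln (G S (X S \<omega>))) - ln (G 0 0) = intensity_cost M S \<nu>"
  unfolding intensity_cost_def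
proof (rule ito_formula_markov[where F="\<lambda>u k. ln (G u k)" and F'="\<lambda>u k. 1 - G u (Suc k) / G u k"
      and K="log_bound + (C\<^sup>2 + 1)" and r="\<lambda>u k. G u (Suc k) / G u k"])
  show "((\<lambda>u. ln (G u k)) has_real_derivative 1 - G u (Suc k) / G u k) (at u within {0..S})"
    if "u \<in> {0..S}" for k u
    by (rule ln_G_deriv[OF that S(2)])
  show "continuous_on {0..S} (\<lambda>u. 1 - G u (Suc k) / G u k)" for k
    by (rule ln_G_deriv_cont[OF S(2)])
  have C2: "0 \<le> C\<^sup>2 + 1"
    by simp
  show "\<bar>ln (G u k)\<bar> \<le> log_bound + (C\<^sup>2 + 1)" "\<bar>1 - G u (Suc k) / G u k\<bar> \<le> log_bound + (C\<^sup>2 + 1)" if "u \<in> {0..S}" for u k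
  proof -
    have "u \<le> T"
      using that S(2) by auto
    from ln_G_bounds[OF this, of k] C2
    show "\<bar>ln (G u k)\<bar> \<le> log_bound + (C\<^sup>2 + 1)" "\<bar>1 - G u (Suc k) / G u k\<bar> \<le> log_bound + (C\<^sup>2 + 1)"
      by linarith+
  qed
  have log_bound: "0 \<le> log_bound"
    using ln_G_bounds(1)[of 0 0] S by auto
  show "phi \<in> borel_measurable borel"
    by (rule phi_measurable)
  show "\<bar>phi x\<bar> \<le> log_bound + (C\<^sup>2 + 1)" if "0 \<le> x" "x \<le> C" for x
    using phi_bound[OF that] log_bound by simp
  show "1 - G u (Suc k) / G u k + G u (Suc k) / G u k * (ln (G u (Suc k)) - ln (G u k)) =
      phi (G u (Suc k) / G u k)" if "u \<in> {0..S}" for k u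
  proof -
    have "0 < G u k" "0 < G u (Suc k)"
      using that S by (auto intro!: G_bounds)
    then show ?thesis
      by (simp add: phi_def ln_div)
  qed
qed (rule foellmer)

text \<open>The h-transform of the test function \<open>h\<close> turns \<open>h (X u)\<close> into a martingale, so that the law
  at time \<open>S\<close> can be read off at time \<open>0\<close>.\<close>

lemma foellmer_law:
  assumes "G 0 0 = 1"
  shows "prob {\<omega> \<in> space M. X S \<omega> = k} = G S k * pmf (poisson_law S) k"
proof -
  \<comment> \<open>The factor \<open>G S k\<close> makes the quotient by \<open>G S\<close> at the
    terminal time the indicator of k, while at time 0 the semigroup picks out \<open>G S k\<close>
    times the Poisson weight of k.\<close>
  define h where "h j = (if j = k then G S k else 0)" for j
  define U where "U u j = poisson_semigroup (S - u) h j" for u j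
  have h: "0 \<le> h j" "h j \<le> C\<^sub>f" "\<bar>h j\<bar> \<le> C\<^sub>f" for j
    using G_bounds[OF S(2), of k] C\<^sub>f by (auto simp: h_def)
  have U: "0 \<le> U u j" "U u j \<le> C\<^sub>f" "\<bar>U u j\<bar> \<le> C\<^sub>f" if "u \<in> {0..S}" for u j
  proof -
    show "0 \<le> U u j" "U u j \<le> C\<^sub>f"
      unfolding U_def using that h by (auto intro!: poisson_semigroup_ge[OF h(3)] poisson_semigroup_le[OF h(3)])
    then show "\<bar>U u j\<bar> \<le> C\<^sub>f"
      by simp
  qed
  have dU: "((\<lambda>u. U u j) has_real_derivative U u j - U u (Suc j)) (at u within {0..S})" if "u \<in> {0..S}" for u j
    unfolding U_def by (rule has_derivative_poisson_semigroup_backward[OF h(3) that order_refl])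
  have cU: "continuous_on {0..S} (\<lambda>u. U u j)" for j
    unfolding U_def by (rule continuous_on_poisson_semigroup_backward[OF h(3) order_refl])
  have G: "0 < G u j" if "u \<in> {0..S}" for u j
    using that S by (intro G_bounds) auto
  define q where "q = C\<^sub>f / c"
  have ratio: "\<bar>x / G u j\<bar> \<le> q" if "u \<in> {0..S}" "\<bar>x\<bar> \<le> C\<^sub>f" for u j x
    unfolding q_def using that S by (intro ratio_bound) auto
  have q: "0 \<le> q"
    using c C\<^sub>f by (simp add: q_def)
  have "expectation (\<lambda>\<omega>. U S (X S \<omega>) / G S (X S \<omega>)) - U 0 0 / G 0 0 =
      expectation (\<lambda>\<omega>. LINT u:{0..S}|lborel. 0)"
  \<comment> \<open>F' is the quotient rule for U / G after inserting the backward equations of U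
    and G. Adding r times the jump of U / G cancels it exactly, so p = 0. The bound q covers one
    quotient by G and q * q the product of two.\<close>
  proof (rule ito_formula_markov[where F="\<lambda>u j. U u j / G u j" and p="\<lambda>_. 0"
        and F'="\<lambda>u j. U u j / G u j * (G u (Suc j) / G u j) - U u (Suc j) / G u j"
        and K="q + q * q" and r="\<lambda>u j. G u (Suc j) / G u j"])
    fix j u assume u: "u \<in> {0..S}"
    show "((\<lambda>u. U u j / G u j) has_real_derivative
        U u j / G u j * (G u (Suc j) / G u j) - U u (Suc j) / G u j) (at u within {0..S})"
      using G[OF u, of j]
      by (auto intro!: derivative_eq_intros G_deriv[OF u S(2)] dU[OF u] simp: field_simps)
    show "\<bar>U u j / G u j\<bar> \<le> q + q * q"
      using ratio[OF u U(3)[OF u, of j], of j] q by (simp add: add_increasing2)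
    have "\<bar>G u (Suc j)\<bar> \<le> C\<^sub>f"
      using G_bounds[of u "Suc j"] u S by simp
    then have "\<bar>U u j / G u j * (G u (Suc j) / G u j)\<bar> \<le> q * q"
      unfolding abs_mult using q by (intro mult_mono ratio U u) auto
    moreover have "\<bar>U u (Suc j) / G u j\<bar> \<le> q"
      by (intro ratio U u)
    ultimately show "\<bar>U u j / G u j * (G u (Suc j) / G u j) - U u (Suc j) / G u j\<bar> \<le> q + q * q"
      by linarith
    show "U u j / G u j * (G u (Suc j) / G u j) - U u (Suc j) / G u j +
        G u (Suc j) / G u j * (U u (Suc j) / G u (Suc j) - U u j / G u j) = 0"
      using G[OF u, of j] G[OF u, of "Suc j"] by (simp add: field_simps)
  next
    fix j
    have "G u j \<noteq> 0" if "u \<in> {0..S}" for u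
      using G[OF that, of j] by simp
    then show "continuous_on {0..S} (\<lambda>u. U u j / G u j * (G u (Suc j) / G u j) - U u (Suc j) / G u j)"
      by (intro continuous_intros cU G_cont S(2)) auto
  qed (use q foellmer in auto)
  moreover have "U S j / G S j = indicat_real {k} j" for j
    using G[of S k] S by (auto simp: U_def poisson_semigroup_0[OF h(3)] h_def)
  moreover have "U 0 0 = G S k * pmf (poisson_law S) k"
  proof -
    have "(\<lambda>n. h (0 + n) * pmf (poisson_law S) n) sums (h (0 + k) * pmf (poisson_law S) k)"
      by (rule sums_single[THEN sums_cong[THEN iffD1, rotated]]) (auto simp: h_def)
    moreover have "(\<lambda>n. h (0 + n) * pmf (poisson_law S) n) sums U 0 0"
      unfolding U_def using poisson_semigroup_sums(1)[of h, OF h(3), of S 0] S by simp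
    ultimately show ?thesis
      using sums_unique2 by (fastforce simp: h_def)
  qed
  moreover have "expectation (\<lambda>\<omega>. indicat_real {k} (X S \<omega>)) = prob {\<omega> \<in> space M. X S \<omega> = k}"
  proof -
    have "expectation (\<lambda>\<omega>. indicat_real {k} (X S \<omega>)) = expectation (indicator {\<omega> \<in> space M. X S \<omega> = k})"
      by (intro Bochner_Integration.integral_cong) (auto simp: indicator_def)
    also have "\<dots> = prob {\<omega> \<in> space M. X S \<omega> = k}"
      by (simp add: Int_absorb2)
    finally show ?thesis .
  qed
  ultimately show ?thesis
    using assms by (simp add: set_lebesgue_integral_def)
qed

end

end

context strip_poisson_process
begin

text \<open>A generating rectangle cut down to the shorter interval is again a generating rectangle,
  with endpoint \<open>min t S\<close>, or is empty when it starts after S.\<close>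

lemma intensity_process_restrict:
  assumes \<nu>: "intensity_process M N T' \<nu>" and "0 \<le> S" "S \<le> T'"
  shows "intensity_process M N S \<nu>"
proof -
  have "(\<lambda>p. p) \<in> measurable (predictable_algebra M N S) (predictable_algebra M N T')"
    unfolding predictable_algebra_def[of M N T']
  proof (rule measurable_measure_of[OF pred_rectangles_closed])
    show "(\<lambda>p. p) \<in> space (predictable_algebra M N S) \<rightarrow> {0..T'} \<times> space M"
      using assms by auto
    fix y assume "y \<in> pred_rectangles T'"
    then obtain s t A where y: "y = {s<..t} \<times> A" "0 \<le> s" "s \<le> t" "A \<in> pp_filtration M N s"
      by blast
    have A: "A \<subseteq> space M"
      using y(4) sets.sets_into_space[of A "past s"] by auto
    show "(\<lambda>p. p) -` y \<inter> space (predictable_algebra M N S) \<in> sets (predictable_algebra M N S)"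
    proof (cases "s \<le> S")
      case True
      then have "0 \<le> s" "s \<le> min t S" "min t S \<le> S"
        using y by auto
      then have "{s<..min t S} \<times> A \<in> pred_rectangles S"
        using y(4) by blast
      moreover have "(\<lambda>p. p) -` y \<inter> space (predictable_algebra M N S) = {s<..min t S} \<times> A"
        using y A by auto
      ultimately show ?thesis
        by (auto simp only: sets_predictable intro: sigma_sets.Basic)
    next
      case False
      then have "(\<lambda>p. p) -` y \<inter> space (predictable_algebra M N S) = {}"
        using y by auto
      then show ?thesis
        by simp
    qed
  qed
  moreover have \<nu>_meas: "(\<lambda>(t, \<omega>). \<nu> t \<omega>) \<in> borel_measurable (predictable_algebra M N T')"
    and "\<forall>t\<in>{0..T'}. \<forall>\<omega>\<in>space M. 0 \<le> \<nu> t \<omega>"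
    and "\<exists>C. \<forall>t\<in>{0..T'}. \<forall>\<omega>\<in>space M. \<nu> t \<omega> \<le> C"
    using \<nu> unfolding intensity_process_def by blast+
  moreover have "{0..S} \<subseteq> {0..T'}"
    using assms(3) by auto
  ultimately show ?thesis
    unfolding intensity_process_def using measurable_compose[OF _ \<nu>_meas] by blast
qed

lemma strip_intensityI:
  assumes "intensity_process M N S \<nu>" "0 \<le> S" "S \<le> T"
  obtains C where "strip_intensity M N T S C \<nu>"
proof -
  obtain C where "\<forall>t\<in>{0..S}. \<forall>\<omega>\<in>space M. \<nu> t \<omega> \<le> C"
    using assms unfolding intensity_process_def by blast
  then have "strip_intensity M N T S C \<nu>"
    using assms unfolding intensity_process_def by unfold_locales auto
  then show ?thesis
    by (rule that)
qed

end

theorem proposition3p3: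
  fixes M :: "'w measure" and N :: "'w \<Rightarrow> (real \<times> real) measure"
    and M' :: "'b measure" and X :: "'b \<Rightarrow> nat" and B :: "nat \<Rightarrow> 'b \<Rightarrow> nat"
    and T a :: real and f :: "nat \<Rightarrow> real" and lam :: "real \<Rightarrow> 'w \<Rightarrow> real"
  assumes "prob_space M" and "prob_space M'"
    and "T > 0" and "0 \<le> a" and "a \<le> 1"
    and "X \<in> measurable M' (count_space UNIV)"
    and "has_poisson_density M' X T f"
    and "\<exists>c C. 0 < c \<and> (\<forall>k. c \<le> f k \<and> f k \<le> C)"
    and "thinning_sequence M' X a B"
    and "poisson_point_process M T N"
    and "poisson_foellmer_intensity M N T f lam"
  shows "let Y = thinning X B; L = distr M' (count_space UNIV) Y in
    distr M (count_space UNIV) (counting_process N lam (a * T)) = L \<and>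
    is_arg_min (intensity_cost M (a * T))
      (\<lambda>\<nu>. \<nu> \<in> admissible_intensities M N (a * T) L) lam \<and>
    poisson_entropy M' Y (a * T) =
      (INF \<nu> \<in> admissible_intensities M N (a * T) L. intensity_cost M (a * T) \<nu>) \<and>
    poisson_entropy M' Y (a * T) = intensity_cost M (a * T) lam"
proof -
  interpret prob_space M by fact
  interpret M': prob_space M' by fact
  interpret strip_poisson_process M N T
    by unfold_locales fact
  define S where "S = a * T"
  have S: "0 \<le> S" "S \<le> T"
    using assms(3-5) mult_right_mono[of a 1 T] by (auto simp: S_def)
  obtain c C\<^sub>f where f: "0 < c" "\<And>k. c \<le> f k" "\<And>k. f k \<le> C\<^sub>f"
    using assms(8) by blast
  interpret bounded_density f c C\<^sub>f T
    by unfold_locales (use f in auto)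
  define Y where "Y = thinning X B"
  define L where "L = distr M' (count_space UNIV) Y"
  note thin = thinning_law[OF assms(2,6,4,5,9) less_imp_le[OF assms(3)] assms(7) f_abs, folded Y_def S_def]
  note [measurable] = thin(1) assms(6)
  have Y_law: "M'.prob {\<omega> \<in> space M'. Y \<omega> = k} = G S k * pmf (poisson_law S) k" for k
    using thin(2)[of k] by (simp add: G_def)
  have L_law: "measure L {k} = G S k * pmf (poisson_law S) k" for k
    unfolding L_def by (subst measure_distr) (auto simp flip: Y_law intro!: arg_cong[where f=M'.prob])
  \<comment> \<open>The series for \<open>G 0 0\<close> adds up the point probabilities of
    X.\<close>
  have G_0: "G 0 0 = 1"
  proof -
    have "(\<lambda>k. M'.prob {\<omega> \<in> space M'. X \<omega> = k}) sums M'.prob (\<Union>k. {\<omega> \<in> space M'. X \<omega> = k})"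
      by (rule M'.finite_measure_UNION) (auto simp: disjoint_family_on_def)
    also have "(\<Union>k. {\<omega> \<in> space M'. X \<omega> = k}) = space M'"
      by auto
    finally have "(\<lambda>k. f (0 + k) * pmf (poisson_law T) k) sums 1"
      using assms(7) by (simp add: has_poisson_density_def M'.prob_space)
    then show ?thesis
      by (simp add: G_def poisson_semigroup_def sums_iff)
  qed
  have entropy: "poisson_entropy M' Y S = (\<Sum>k. G S k * pmf (poisson_law S) k * ln (G S k))"
    unfolding poisson_entropy_def
  proof (rule suminf_cong)
    fix k
    \<comment> \<open>For S = 0 the weights of k > 0 vanish; there both sides are 0, whatever value
      the quotient in \<open>poisson_density\<close> takes.\<close>
    show "poisson_density M' Y S k * ln (poisson_density M' Y S k) * pmf (poisson_law S) k =
        G S k * pmf (poisson_law S) k * ln (G S k)"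
      by (cases "pmf (poisson_law S) k = 0") (simp_all add: poisson_density_def Y_law)
  qed
  \<comment> \<open>The entropy depends on the law alone, so it can be evaluated on M along any
    counting process with that terminal law. This is what connects it with Ito's formula.\<close>
  have entropy_eq: "poisson_entropy M' Y S = expectation (\<lambda>\<omega>. ln (G S (counting_process N \<nu> S \<omega>)))"
    if "\<And>k. prob {\<omega> \<in> space M. counting_process N \<nu> S \<omega> = k} = G S k * pmf (poisson_law S) k"
      "counting_process N \<nu> S \<in> measurable M (count_space UNIV)" for \<nu>
    using expectation_nat_valued[OF that(2), of "\<lambda>k. ln (G S k)", OF ln_G_bounds(1)[OF S(2)]]
    by (simp add: entropy that(1))
  have entropy_le: "poisson_entropy M' Y S \<le> intensity_cost M S \<nu>"
    if \<nu>: "\<nu> \<in> admissible_intensities M N S L" for \<nu>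
  proof -
    have "intensity_process M N S \<nu>"
      using \<nu> by (simp add: admissible_intensities_def)
    then obtain C where "strip_intensity M N T S C \<nu>"
      using S by (rule strip_intensityI)
    then interpret foellmer_setup M N T S C \<nu> f c C\<^sub>f
      by (intro foellmer_setup.intro bounded_density_axioms)
    have X[measurable]: "counting_process N \<nu> S \<in> measurable M (count_space UNIV)"
      using S by (intro counting_process_measurable) auto
    have "prob {\<omega> \<in> space M. counting_process N \<nu> S \<omega> = k} = measure (distr M (count_space UNIV) (counting_process N \<nu> S)) {k}" for k
      by (subst measure_distr) (auto intro!: arg_cong[where f=prob])
    then have "prob {\<omega> \<in> space M. counting_process N \<nu> S \<omega> = k} = G S k * pmf (poisson_law S) k" for k
      using \<nu> by (simp add: admissible_intensities_def L_law)
    from entropy_eq[OF this X] expectation_ln_G_le_cost G_0 show ?thesis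
      by simp
  qed
  have lam: "intensity_process M N S lam"
    using assms(11) intensity_process_restrict[OF _ S] unfolding poisson_foellmer_intensity_def by blast
  then obtain C where "strip_intensity M N T S C lam"
    using S by (rule strip_intensityI)
  then interpret foellmer_setup M N T S C lam f c C\<^sub>f
    by (intro foellmer_setup.intro bounded_density_axioms)
  have X_meas[measurable]: "counting_process N lam S \<in> measurable M (count_space UNIV)"
    using S by (intro counting_process_measurable) auto
  have foellmer: "AE \<omega> in M. \<forall>u\<in>{0..S}. lam u \<omega> =
      G u (Suc (counting_process N lam u \<omega>)) / G u (counting_process N lam u \<omega>)"
    using assms(11) S unfolding poisson_foellmer_intensity_def G_def
    by (auto elim!: eventually_mono)
  note law = foellmer_law[OF foellmer G_0]
  have distr_eq: "distr M (count_space UNIV) (counting_process N lam S) = L"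
  proof (rule measure_eqI_countable)
    fix k
    have "emeasure (distr M (count_space UNIV) (counting_process N lam S)) {k} =
        emeasure M {\<omega> \<in> space M. counting_process N lam S \<omega> = k}"
      by (subst emeasure_distr) (auto intro!: arg_cong[where f="emeasure M"])
    moreover have "emeasure L {k} = emeasure M' {\<omega> \<in> space M'. Y \<omega> = k}"
      unfolding L_def by (subst emeasure_distr) (auto intro!: arg_cong[where f="emeasure M'"])
    ultimately show "emeasure (distr M (count_space UNIV) (counting_process N lam S)) {k} = emeasure L {k}"
      by (simp add: emeasure_eq_measure M'.emeasure_eq_measure law Y_law)
  qed (auto simp: L_def)
  have cost: "poisson_entropy M' Y S = intensity_cost M S lam"
    using entropy_eq[OF law X_meas] expectation_ln_G_eq_cost[OF foellmer] G_0 by simp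
  have adm: "lam \<in> admissible_intensities M N S L"
    using lam distr_eq by (simp add: admissible_intensities_def)
  \<comment> \<open>The infimum is attained at \<open>lam\<close>, so it is a minimum of a set of
    reals and no separate lower-bound argument for the real-valued \<open>INF\<close>
    arises.\<close>
  have "(INF \<nu> \<in> admissible_intensities M N S L. intensity_cost M S \<nu>) = intensity_cost M S lam"
    by (rule cInf_eq_minimum) (use adm entropy_le cost in auto)
  moreover have "is_arg_min (intensity_cost M S) (\<lambda>\<nu>. \<nu> \<in> admissible_intensities M N S L) lam"
    using adm entropy_le cost by (fastforce simp: is_arg_min_def)
  ultimately show ?thesis
    unfolding Let_def Y_def[symmetric] L_def[symmetric] S_def[symmetric] using distr_eq cost by simp
qed

end
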